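(* Let $p$ be a prime, $d\ge1$, let $\widetilde d$ be a (deformed) ultrametric on $\mathbb{Q}_p^d$, and let $A$ be a $d\times d$ matrix with integer entries which is a dilation of $\mathbb{Q}_p^d$ with respect to $\widetilde d$, with $|\det A|_p=p^{-1}$. Let $\mathcal{D}=\{n_0,\dots,n_{p-1}\}\subset\mathbb{Z}^d$ be an arbitrary fixed set of digits, i.e. vectors with integer coordinates which represent all elements of $\mathbb{Z}_p^d/A\mathbb{Z}_p^d$, and let $\rho$ be the map of $\mathbb{Q}_p^d$ to a subset of $\mathbb{R}^d$ given by $$\rho:\ \sum_{i=\gamma}^\infty A^ix_i\ \mapsto\ \sum_{i=\gamma}^\infty A^{-i-1}x_i,\qquad \gamma\in\mathbb{Z},\ x_i\in\mathcal{D}.$$ Suppose that $\rho$ conserves the measure, i.e. the Lebesgue measure of the image of a set is equal to the Haar measure of this set. Then: 1) The following two conditions are satisfied: (A) the subset $R=\left\{\sum_{i=0}^\infty A^{-i-1}x_i\right\}$ of $\mathbb{R}^d$, where the $x_i$ are the digits (integer representatives from $\mathbb{Z}^d/A\mathbb{Z}^d$), is Lebesgue measurable with measure equal to one; (B) the Lebesgue measure of the intersection $R\cap(R+k)$ is equal to zero for all nonzero $k\in\mathbb{Z}^d$. 2) $|\det A|_p=|\det A|^{-1}$, where $|\cdot|$ on the right is the usual real absolute value.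
   Context: $|x|_p=\max_l|x_l|_p$ on $\mathbb{Q}_p^d$. The Haar measure on $\mathbb{Q}_p^d$ is normalized so that $\mathbb{Z}_p^d$ has measure one. A deformed ultrametric on $\mathbb{Q}_p^d$ is a metric of the form $\widetilde d(x,y)=\max_{1\le l\le d} q_l|(Ux)_l-(Uy)_l|_p$ with $p^{-1}<q_l\le 1$ and $U\in O_d$, where $O_d$ is the group of linear transformations of $\mathbb{Q}_p^d$ preserving $|\cdot|_p$ (equivalently, matrices with entries in $\mathbb{Z}_p$ and $|\det|_p=1$). A dilation with respect to $\widetilde d$ is a linear map $\mathbb{Q}_p^d\to\mathbb{Q}_p^d$ which maps any $\widetilde d$-ball (of positive radius) with center at zero onto a maximal proper $\widetilde d$-subball with center at zero of this ball. The map $\rho$ is defined through the representation of the elements of $\mathbb{Q}_p^d$ as series $\sum_{i=\gamma}^\infty A^ix_i$ with digits $x_i\in\mathcal{D}$; since the digits and the matrix elements of $A$ are rational integers, $\rho$ is taken to be correctly defined. It depends on the choice of the digits. *)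

theory Defs
  imports "HOL-Analysis.Analysis" "HOL-Computational_Algebra.Primes"
begin

section \<open>The p-adic absolute value on the rationals\<close>

definition rat_padic_abs :: "nat \<Rightarrow> rat \<Rightarrow> real" where
  "rat_padic_abs p x = (if x = 0 then 0 else
     real p powi (int (multiplicity (int p) (snd (quotient_of x)))
                  - int (multiplicity (int p) (fst (quotient_of x)))))"

lemma rat_padic_abs_0 [simp]: "rat_padic_abs p 0 = 0"
  by (simp add: rat_padic_abs_def)

lemma rat_padic_abs_divide:
  assumes p: "prime p" and "a \<noteq> 0" "b \<noteq> 0"
  shows "rat_padic_abs p (of_int a / of_int b)
    = real p powi (int (multiplicity (int p) b) - int (multiplicity (int p) a))"
proof -
  obtain c e where ce: "quotient_of (of_int a / of_int b) = (c, e)"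
    by (cases "quotient_of (of_int a / of_int b)")
  have e: "e > 0" using quotient_of_denom_pos[OF ce] .
  have eq: "(of_int a / of_int b :: rat) = of_int c / of_int e"
    using quotient_of_div[OF ce] .
  have "(of_int a / of_int b :: rat) \<noteq> 0" using assms by simp
  hence c: "c \<noteq> 0" using eq by auto
  have "of_int (a * e) = (of_int (c * b) :: rat)"
    using eq e assms by (simp add: field_simps)
  hence "a * e = c * b" by (simp only: of_int_eq_iff)
  moreover have pe: "prime_elem (int p)" using p by simp
  ultimately have "multiplicity (int p) a + multiplicity (int p) e
      = multiplicity (int p) c + multiplicity (int p) b"
    using assms c e by (metis less_irrefl prime_elem_multiplicity_mult_distrib)
  hence "int (multiplicity (int p) b) - int (multiplicity (int p) a)
      = int (multiplicity (int p) e) - int (multiplicity (int p) c)" by linarith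
  thus ?thesis using ce assms by (simp add: rat_padic_abs_def)
qed

lemma rat_eq_int_div: obtains a b :: int where "x = (of_int a / of_int b :: rat)" "b \<noteq> 0"
proof -
  obtain c e where ce: "quotient_of x = (c, e)" by (cases "quotient_of x")
  show ?thesis using that[of c e] quotient_of_div[OF ce] quotient_of_denom_pos[OF ce] by simp
qed

context
  fixes p :: nat assumes p: "prime p"
begin

lemma rat_padic_abs_pos: "x \<noteq> 0 \<Longrightarrow> rat_padic_abs p x > 0"
  using prime_gt_0_nat[OF p] by (simp add: rat_padic_abs_def)

lemma rat_padic_abs_nonneg: "rat_padic_abs p x \<ge> 0"
  using rat_padic_abs_pos[of x] by (cases "x = 0") auto

lemma rat_padic_abs_1: "rat_padic_abs p 1 = 1"
  using rat_padic_abs_divide[OF p, of 1 1] by simp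

lemma rat_padic_abs_mult: "rat_padic_abs p (x * y) = rat_padic_abs p x * rat_padic_abs p y"
proof (cases "x = 0 \<or> y = 0")
  case False
  obtain a b where x: "x = of_int a / of_int b" "b \<noteq> 0" by (rule rat_eq_int_div)
  obtain c e where y: "y = of_int c / of_int e" "e \<noteq> 0" by (rule rat_eq_int_div)
  have ac: "a \<noteq> 0" "c \<noteq> 0" using False x y by auto
  have "x * y = of_int (a * c) / of_int (b * e)" using x y by simp
  hence "rat_padic_abs p (x * y) = real p powi (int (multiplicity (int p) (b * e))
      - int (multiplicity (int p) (a * c)))"
    using rat_padic_abs_divide[OF p, of "a * c" "b * e"] x y ac by simp
  also have "\<dots> = real p powi ((int (multiplicity (int p) b) - int (multiplicity (int p) a))
     + (int (multiplicity (int p) e) - int (multiplicity (int p) c)))"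
    using x y ac p by (simp add: prime_elem_multiplicity_mult_distrib algebra_simps)
  also have "\<dots> = rat_padic_abs p x * rat_padic_abs p y"
    using x y ac p by (simp add: rat_padic_abs_divide power_int_add prime_gt_0_nat)
  finally show ?thesis .
qed auto

lemma rat_padic_abs_minus: "rat_padic_abs p (- x) = rat_padic_abs p x"
proof -
  have "rat_padic_abs p (-1) ^ 2 = 1"
    using rat_padic_abs_mult[of "-1" "-1"] rat_padic_abs_1 by (simp add: power2_eq_square)
  hence "rat_padic_abs p (-1) = 1"
    using rat_padic_abs_nonneg[of "-1"] by (simp add: power2_eq_1_iff)
  thus ?thesis using rat_padic_abs_mult[of "-1" x] by simp
qed

lemma rat_padic_abs_diff_commute: "rat_padic_abs p (x - y) = rat_padic_abs p (y - x)"
  using rat_padic_abs_minus[of "x - y"] by simp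

lemma rat_padic_abs_add_le: "rat_padic_abs p (x + y) \<le> max (rat_padic_abs p x) (rat_padic_abs p y)"
proof (cases "x = 0 \<or> y = 0 \<or> x + y = 0")
  case True
  thus ?thesis using rat_padic_abs_nonneg by (auto simp: le_max_iff_disj)
next
  case False
  obtain a b where x: "x = of_int a / of_int b" "b \<noteq> 0" by (rule rat_eq_int_div)
  obtain c e where y: "y = of_int c / of_int e" "e \<noteq> 0" by (rule rat_eq_int_div)
  define u v w where "u = a * e" and "v = c * b" and "w = b * e"
  have w: "w \<noteq> 0" using x y by (simp add: w_def)
  have xw: "x = of_int u / of_int w" and yw: "y = of_int v / of_int w"
    using x y by (simp_all add: u_def v_def w_def field_simps)
  have sw: "x + y = of_int (u + v) / of_int w" by (simp add: xw yw add_divide_distrib)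
  have nz: "u \<noteq> 0" "v \<noteq> 0" "u + v \<noteq> 0" using False xw yw sw by auto
  define m where "m = min (multiplicity (int p) u) (multiplicity (int p) v)"
  have "int p ^ m dvd u" "int p ^ m dvd v"
    by (simp_all add: m_def multiplicity_dvd')
  hence "int p ^ m dvd u + v" by simp
  hence "m \<le> multiplicity (int p) (u + v)"
    using nz p by (intro multiplicity_geI) (auto simp: prime_gt_1_nat not_prime_unit)
  hence "int (multiplicity (int p) w) - int (multiplicity (int p) (u + v))
      \<le> max (int (multiplicity (int p) w) - int (multiplicity (int p) u))
           (int (multiplicity (int p) w) - int (multiplicity (int p) v))"
    unfolding m_def by linarith
  hence "real p powi (int (multiplicity (int p) w) - int (multiplicity (int p) (u + v)))
      \<le> max (real p powi (int (multiplicity (int p) w) - int (multiplicity (int p) u)))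
           (real p powi (int (multiplicity (int p) w) - int (multiplicity (int p) v)))"
    using prime_gt_1_nat[OF p] by (auto simp: le_max_iff_disj intro!: power_int_increasing)
  thus ?thesis
    unfolding sw xw yw using rat_padic_abs_divide[OF p] nz w
    by (metis add_divide_distrib of_int_add)
qed

lemma rat_padic_abs_triangle: "rat_padic_abs p (x + y) \<le> rat_padic_abs p x + rat_padic_abs p y"
  using rat_padic_abs_add_le[of x y] rat_padic_abs_nonneg[of x] rat_padic_abs_nonneg[of y]
  by linarith

lemma rat_padic_abs_inverse: "rat_padic_abs p (inverse x) = inverse (rat_padic_abs p x)"
proof (cases "x = 0")
  case False
  hence "rat_padic_abs p x * rat_padic_abs p (inverse x) = 1"
    using rat_padic_abs_mult[of x "inverse x"] rat_padic_abs_1 by simp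
  thus ?thesis by (metis inverse_unique)
qed simp

lemma rat_padic_abs_abs_diff:
  "\<bar>rat_padic_abs p x - rat_padic_abs p y\<bar> \<le> rat_padic_abs p (x - y)"
  using rat_padic_abs_triangle[of "x - y" y] rat_padic_abs_triangle[of "y - x" x]
    rat_padic_abs_diff_commute[of x y] by simp

end

section \<open>The field of p-adic numbers, with p the cardinality of the type parameter\<close>

class prime_card = finite +
  assumes prime_card: "prime (CARD('a))"

definition padic_vanishes :: "'p::prime_card itself \<Rightarrow> (nat \<Rightarrow> rat) \<Rightarrow> bool" where
  "padic_vanishes _ X \<longleftrightarrow> (\<lambda>n. rat_padic_abs CARD('p) (X n)) \<longlonglongrightarrow> 0"

definition padic_cauchy :: "'p::prime_card itself \<Rightarrow> (nat \<Rightarrow> rat) \<Rightarrow> bool" where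
  "padic_cauchy _ X \<longleftrightarrow>
     (\<forall>r>0. \<exists>k. \<forall>m\<ge>k. \<forall>n\<ge>k. rat_padic_abs CARD('p) (X m - X n) < r)"

lemma padic_vanishes_bound:
  assumes "padic_vanishes TYPE('p::prime_card) Y" "\<forall>\<^sub>F n in sequentially. rat_padic_abs CARD('p) (X n) \<le> K * rat_padic_abs CARD('p) (Y n)"
  shows "padic_vanishes TYPE('p) X"
proof -
  have "(\<lambda>n. K * rat_padic_abs CARD('p) (Y n)) \<longlonglongrightarrow> 0"
    using tendsto_mult_left[of _ 0 _ K] assms(1) by (simp add: padic_vanishes_def)
  thus ?thesis
    unfolding padic_vanishes_def
    by (rule tendsto_sandwich[rotated 2, OF tendsto_const])
      (use assms(2) rat_padic_abs_nonneg[OF prime_card] in \<open>auto intro: always_eventually\<close>)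
qed

lemma padic_vanishes_const [simp]: "padic_vanishes TYPE('p::prime_card) (\<lambda>n. c) \<longleftrightarrow> c = 0"
  using rat_padic_abs_pos[OF prime_card[where 'a='p], of c]
  by (cases "c = 0") (auto simp: padic_vanishes_def LIMSEQ_const_iff)

lemma padic_vanishes_minus: "padic_vanishes TYPE('p::prime_card) X \<Longrightarrow> padic_vanishes TYPE('p) (\<lambda>n. - X n)"
  by (simp add: padic_vanishes_def rat_padic_abs_minus[OF prime_card])

lemma padic_vanishes_add:
  assumes "padic_vanishes TYPE('p::prime_card) X" "padic_vanishes TYPE('p) Y"
  shows "padic_vanishes TYPE('p) (\<lambda>n. X n + Y n)"
proof -
  have "(\<lambda>n. rat_padic_abs CARD('p) (X n) + rat_padic_abs CARD('p) (Y n)) \<longlonglongrightarrow> 0"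
    using tendsto_add[of _ 0 _ _ 0] assms by (simp add: padic_vanishes_def)
  thus ?thesis
    unfolding padic_vanishes_def
    by (rule tendsto_sandwich[rotated 2, OF tendsto_const])
      (auto intro!: always_eventually rat_padic_abs_nonneg rat_padic_abs_triangle prime_card)
qed

lemma padic_vanishes_diff:
  "padic_vanishes TYPE('p::prime_card) X \<Longrightarrow> padic_vanishes TYPE('p) Y \<Longrightarrow> padic_vanishes TYPE('p) (\<lambda>n. X n - Y n)"
  using padic_vanishes_add[where 'p='p, of X "\<lambda>n. - Y n"] padic_vanishes_minus[where 'p='p, of Y]
  by simp

lemma padic_cauchy_const [simp]: "padic_cauchy TYPE('p::prime_card) (\<lambda>n. c)"
  by (simp add: padic_cauchy_def)

lemma padic_cauchy_minus: "padic_cauchy TYPE('p::prime_card) X \<Longrightarrow> padic_cauchy TYPE('p) (\<lambda>n. - X n)"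
  unfolding padic_cauchy_def
  by (metis (no_types, lifting) minus_diff_minus rat_padic_abs_minus[OF prime_card])

lemma padic_cauchy_add:
  assumes "padic_cauchy TYPE('p::prime_card) X" "padic_cauchy TYPE('p) Y"
  shows "padic_cauchy TYPE('p) (\<lambda>n. X n + Y n)"
  unfolding padic_cauchy_def
proof (intro allI impI)
  fix r :: real assume "r > 0"
  then obtain i j where i: "\<forall>m\<ge>i. \<forall>n\<ge>i. rat_padic_abs CARD('p) (X m - X n) < r"
    and j: "\<forall>m\<ge>j. \<forall>n\<ge>j. rat_padic_abs CARD('p) (Y m - Y n) < r"
    using assms unfolding padic_cauchy_def by blast
  have "rat_padic_abs CARD('p) (X m + Y m - (X n + Y n)) < r" if "m \<ge> max i j" "n \<ge> max i j" for m n
  proof -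
    have "rat_padic_abs CARD('p) ((X m - X n) + (Y m - Y n)) \<le> max (rat_padic_abs CARD('p) (X m - X n)) (rat_padic_abs CARD('p) (Y m - Y n))"
      by (rule rat_padic_abs_add_le[OF prime_card])
    moreover have "rat_padic_abs CARD('p) (X m - X n) < r" "rat_padic_abs CARD('p) (Y m - Y n) < r" using i j that by auto
    ultimately show ?thesis by (simp add: algebra_simps)
  qed
  thus "\<exists>k. \<forall>m\<ge>k. \<forall>n\<ge>k. rat_padic_abs CARD('p) (X m + Y m - (X n + Y n)) < r" by blast
qed

lemma padic_cauchy_convergent:
  assumes "padic_cauchy TYPE('p::prime_card) X"
  shows "convergent (\<lambda>n. rat_padic_abs CARD('p) (X n))"
proof (rule Cauchy_convergent, rule CauchyI)
  fix r :: real assume "r > 0"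
  then obtain k where "\<forall>m\<ge>k. \<forall>n\<ge>k. rat_padic_abs CARD('p) (X m - X n) < r"
    using assms unfolding padic_cauchy_def by blast
  thus "\<exists>k. \<forall>m\<ge>k. \<forall>n\<ge>k. norm (rat_padic_abs CARD('p) (X m) - rat_padic_abs CARD('p) (X n)) < r"
    using rat_padic_abs_abs_diff[OF prime_card[where 'a='p]]
    by (metis le_less_trans real_norm_def)
qed

lemma padic_cauchy_bounded:
  assumes "padic_cauchy TYPE('p::prime_card) X"
  obtains K where "K > 0" "\<And>n. rat_padic_abs CARD('p) (X n) \<le> K"
proof -
  have "Bseq (\<lambda>n. rat_padic_abs CARD('p) (X n))"
    using padic_cauchy_convergent[OF assms] by (rule convergent_imp_Bseq)
  then obtain K where "K > 0" "\<forall>n. norm (rat_padic_abs CARD('p) (X n)) \<le> K" by (rule BseqE)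
  thus ?thesis using that[of K] by (metis abs_ge_self order_trans real_norm_def)
qed

lemma padic_cauchy_mult:
  assumes "padic_cauchy TYPE('p::prime_card) X" "padic_cauchy TYPE('p) Y"
  shows "padic_cauchy TYPE('p) (\<lambda>n. X n * Y n)"
  unfolding padic_cauchy_def
proof (intro allI impI)
  fix r :: real assume "r > 0"
  obtain K where K: "K > 0" "\<And>n. rat_padic_abs CARD('p) (X n) \<le> K" using padic_cauchy_bounded[OF assms(1)] by blast
  obtain L where L: "L > 0" "\<And>n. rat_padic_abs CARD('p) (Y n) \<le> L" using padic_cauchy_bounded[OF assms(2)] by blast
  obtain i where i: "\<forall>m\<ge>i. \<forall>n\<ge>i. rat_padic_abs CARD('p) (X m - X n) < r / L"
    using assms(1) \<open>r > 0\<close> L unfolding padic_cauchy_def by (meson divide_pos_pos)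
  obtain j where j: "\<forall>m\<ge>j. \<forall>n\<ge>j. rat_padic_abs CARD('p) (Y m - Y n) < r / K"
    using assms(2) \<open>r > 0\<close> K unfolding padic_cauchy_def by (meson divide_pos_pos)
  have "rat_padic_abs CARD('p) (X m * Y m - X n * Y n) < r" if "m \<ge> max i j" "n \<ge> max i j" for m n
  proof -
    have "rat_padic_abs CARD('p) (X m * (Y m - Y n)) \<le> K * rat_padic_abs CARD('p) (Y m - Y n)"
      using K by (auto simp: rat_padic_abs_mult[OF prime_card]
          intro!: mult_right_mono rat_padic_abs_nonneg prime_card)
    also have "\<dots> < r" using j that K by (simp add: pos_less_divide_eq mult.commute)
    finally have 1: "rat_padic_abs CARD('p) (X m * (Y m - Y n)) < r" .
    have "rat_padic_abs CARD('p) ((X m - X n) * Y n) \<le> rat_padic_abs CARD('p) (X m - X n) * L"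
      using L by (auto simp: rat_padic_abs_mult[OF prime_card]
          intro!: mult_left_mono rat_padic_abs_nonneg prime_card)
    also have "\<dots> < r" using i that L by (simp add: pos_less_divide_eq)
    finally have 2: "rat_padic_abs CARD('p) ((X m - X n) * Y n) < r" .
    have "X m * Y m - X n * Y n = X m * (Y m - Y n) + (X m - X n) * Y n"
      by (simp add: algebra_simps)
    thus ?thesis using 1 2
        rat_padic_abs_add_le[OF prime_card[where 'a='p], of "X m * (Y m - Y n)" "(X m - X n) * Y n"]
      by simp
  qed
  thus "\<exists>k. \<forall>m\<ge>k. \<forall>n\<ge>k. rat_padic_abs CARD('p) (X m * Y m - X n * Y n) < r" by blast
qed

lemma padic_vanishes_mult:
  assumes "padic_cauchy TYPE('p::prime_card) X" "padic_vanishes TYPE('p) Y"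
  shows "padic_vanishes TYPE('p) (\<lambda>n. X n * Y n)"
proof -
  obtain K where K: "K > 0" "\<And>n. rat_padic_abs CARD('p) (X n) \<le> K" using padic_cauchy_bounded[OF assms(1)] by blast
  show ?thesis
    by (rule padic_vanishes_bound[OF assms(2), of _ K])
      (use K in \<open>auto simp: rat_padic_abs_mult[OF prime_card]
          intro!: always_eventually mult_right_mono rat_padic_abs_nonneg prime_card\<close>)
qed

lemma padic_cauchy_not_vanishes:
  assumes "padic_cauchy TYPE('p::prime_card) X" "\<not> padic_vanishes TYPE('p) X"
  obtains b k where "b > 0" "\<And>n. n \<ge> k \<Longrightarrow> b < rat_padic_abs CARD('p) (X n)"
proof -
  obtain l where l: "(\<lambda>n. rat_padic_abs CARD('p) (X n)) \<longlonglongrightarrow> l"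
    using padic_cauchy_convergent[OF assms(1)] by (auto simp: convergent_def)
  have "l \<ge> 0" using l by (rule LIMSEQ_le_const) (auto intro: rat_padic_abs_nonneg prime_card)
  moreover have "l \<noteq> 0" using l assms(2) by (auto simp: padic_vanishes_def)
  ultimately have "l / 2 < l" "l / 2 > 0" by auto
  from order_tendstoD(1)[OF l this(1)] obtain k where "\<forall>n\<ge>k. l / 2 < rat_padic_abs CARD('p) (X n)"
    by (auto simp: eventually_sequentially)
  thus ?thesis using that[of "l / 2" k] \<open>l / 2 > 0\<close> by blast
qed

lemma rat_padic_abs_inverse_diff:
  assumes "b > 0" "b < rat_padic_abs CARD('p::prime_card) x" "c > 0" "c < rat_padic_abs CARD('p) y"
  shows "rat_padic_abs CARD('p) (inverse x - inverse y)
    \<le> inverse b * inverse c * rat_padic_abs CARD('p) (x - y)"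
proof -
  have nz: "x \<noteq> 0" "y \<noteq> 0" using assms by auto
  hence "inverse x - inverse y = inverse x * inverse y * (y - x)" by (simp add: field_simps)
  hence "rat_padic_abs CARD('p) (inverse x - inverse y) = inverse (rat_padic_abs CARD('p) x) * inverse (rat_padic_abs CARD('p) y) * rat_padic_abs CARD('p) (x - y)"
    by (simp add: rat_padic_abs_mult[OF prime_card] rat_padic_abs_inverse[OF prime_card]
        rat_padic_abs_diff_commute[OF prime_card, of x y])
  also have "\<dots> \<le> inverse b * inverse c * rat_padic_abs CARD('p) (x - y)"
    using assms rat_padic_abs_nonneg[OF prime_card[where 'a='p]]
    by (intro mult_right_mono mult_mono) (auto intro: le_imp_inverse_le)
  finally show ?thesis .
qed

lemma padic_cauchy_inverse:
  assumes "padic_cauchy TYPE('p::prime_card) X" "\<not> padic_vanishes TYPE('p) X"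
  shows "padic_cauchy TYPE('p) (\<lambda>n. inverse (X n))"
  unfolding padic_cauchy_def
proof (intro allI impI)
  fix r :: real assume "r > 0"
  obtain b k where b: "b > 0" "\<And>n. n \<ge> k \<Longrightarrow> b < rat_padic_abs CARD('p) (X n)"
    using padic_cauchy_not_vanishes[OF assms] by blast
  have "r * b * b > 0" using \<open>r > 0\<close> b by simp
  then obtain j where j: "\<forall>m\<ge>j. \<forall>n\<ge>j. rat_padic_abs CARD('p) (X m - X n) < r * b * b"
    using assms(1) unfolding padic_cauchy_def by blast
  have "rat_padic_abs CARD('p) (inverse (X m) - inverse (X n)) < r" if "m \<ge> max j k" "n \<ge> max j k" for m n
  proof -
    have "rat_padic_abs CARD('p) (inverse (X m) - inverse (X n)) \<le> inverse b * inverse b * rat_padic_abs CARD('p) (X m - X n)"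
      using that b by (intro rat_padic_abs_inverse_diff) auto
    also have "\<dots> < inverse b * inverse b * (r * b * b)"
      using that j b by (intro mult_strict_left_mono) auto
    also have "\<dots> = r" using b(1) by (simp add: field_simps)
    finally show ?thesis .
  qed
  thus "\<exists>k. \<forall>m\<ge>k. \<forall>n\<ge>k. rat_padic_abs CARD('p) (inverse (X m) - inverse (X n)) < r" by blast
qed

lemma padic_vanishes_diff_inverse:
  assumes "padic_cauchy TYPE('p::prime_card) X" "\<not> padic_vanishes TYPE('p) X"
    and "padic_cauchy TYPE('p) Y" "\<not> padic_vanishes TYPE('p) Y"
    and "padic_vanishes TYPE('p) (\<lambda>n. X n - Y n)"
  shows "padic_vanishes TYPE('p) (\<lambda>n. inverse (X n) - inverse (Y n))"
proof -
  obtain b k where b: "b > 0" "\<And>n. n \<ge> k \<Longrightarrow> b < rat_padic_abs CARD('p) (X n)"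
    using padic_cauchy_not_vanishes[OF assms(1,2)] by blast
  obtain c l where c: "c > 0" "\<And>n. n \<ge> l \<Longrightarrow> c < rat_padic_abs CARD('p) (Y n)"
    using padic_cauchy_not_vanishes[OF assms(3,4)] by blast
  have *: "\<forall>n\<ge>max k l. rat_padic_abs CARD('p) (inverse (X n) - inverse (Y n)) \<le> inverse b * inverse c * rat_padic_abs CARD('p) (X n - Y n)"
    using b c by (auto intro!: rat_padic_abs_inverse_diff)
  show ?thesis
    using * by (intro padic_vanishes_bound[OF assms(5), of _ "inverse b * inverse c"])
      (unfold eventually_sequentially, blast)
qed

text \<open>\<open>'p padic\<close> is the ring of \<open>p\<close>-adic Cauchy sequences of rationals modulo the
  maximal ideal of null sequences, where \<open>p = CARD('p)\<close>.\<close>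

typedef (overloaded) ('p::prime_card) padic_seq = "{X. padic_cauchy TYPE('p) X}"
  by (rule exI[of _ "\<lambda>_. 0"]) simp

setup_lifting type_definition_padic_seq

instantiation padic_seq :: (prime_card) comm_ring_1
begin

lift_definition zero_padic_seq :: "'a padic_seq" is "\<lambda>_. 0" by simp
lift_definition one_padic_seq :: "'a padic_seq" is "\<lambda>_. 1" by simp
lift_definition uminus_padic_seq :: "'a padic_seq \<Rightarrow> 'a padic_seq" is "\<lambda>X n. - X n"
  by (rule padic_cauchy_minus)
lift_definition plus_padic_seq :: "'a padic_seq \<Rightarrow> 'a padic_seq \<Rightarrow> 'a padic_seq"
  is "\<lambda>X Y n. X n + Y n" by (rule padic_cauchy_add)
lift_definition minus_padic_seq :: "'a padic_seq \<Rightarrow> 'a padic_seq \<Rightarrow> 'a padic_seq"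
  is "\<lambda>X Y n. X n - Y n"
  using padic_cauchy_add[OF _ padic_cauchy_minus] by fastforce
lift_definition times_padic_seq :: "'a padic_seq \<Rightarrow> 'a padic_seq \<Rightarrow> 'a padic_seq"
  is "\<lambda>X Y n. X n * Y n" by (rule padic_cauchy_mult)

instance
  by standard (transfer; simp add: algebra_simps fun_eq_iff)+

end

lift_definition padic_null :: "'p::prime_card padic_seq \<Rightarrow> bool" is "padic_vanishes TYPE('p)" .

lemma padic_null_0 [simp]: "padic_null 0"
  by transfer simp

lemma padic_null_1 [simp]: "\<not> padic_null 1"
  by transfer simp

lemma padic_null_minus: "padic_null X \<Longrightarrow> padic_null (- X)"
  by transfer (rule padic_vanishes_minus)

lemma padic_null_add: "padic_null X \<Longrightarrow> padic_null Y \<Longrightarrow> padic_null (X + Y)"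
  by transfer (rule padic_vanishes_add)

lemma padic_null_mult: "padic_null Y \<Longrightarrow> padic_null (X * Y)"
  by transfer (rule padic_vanishes_mult)

definition padic_rel :: "'p::prime_card padic_seq \<Rightarrow> 'p padic_seq \<Rightarrow> bool" where
  "padic_rel X Y \<longleftrightarrow> padic_null (X - Y)"

lemma equivp_padic_rel: "equivp padic_rel"
proof (rule equivpI)
  show "reflp padic_rel" by (rule reflpI) (simp add: padic_rel_def)
  show "symp padic_rel"
    by (rule sympI) (auto simp: padic_rel_def dest: padic_null_minus)
  show "transp padic_rel"
    by (rule transpI) (auto simp: padic_rel_def dest: padic_null_add)
qed

quotient_type (overloaded) 'p padic = "'p::prime_card padic_seq" / padic_rel
  by (rule equivp_padic_rel)

lift_definition inverse_padic_seq :: "'p::prime_card padic_seq \<Rightarrow> 'p padic_seq"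
  is "\<lambda>X. if padic_vanishes TYPE('p) X then (\<lambda>_. 0) else (\<lambda>n. inverse (X n))"
  by (auto intro: padic_cauchy_inverse)

lemma inverse_padic_seq_null: "padic_null X \<Longrightarrow> inverse_padic_seq X = 0"
  by transfer simp

lemma inverse_padic_seq_rel:
  "\<not> padic_null X \<Longrightarrow> \<not> padic_null Y \<Longrightarrow> padic_null (X - Y) \<Longrightarrow>
     padic_null (inverse_padic_seq X - inverse_padic_seq Y)"
  by transfer (auto intro: padic_vanishes_diff_inverse)

lemma inverse_padic_seq_mult:
  assumes "\<not> padic_null X"
  shows "padic_null (inverse_padic_seq X * X - 1)"
  using assms
proof transfer
  fix X :: "nat \<Rightarrow> rat"
  assume X: "padic_cauchy TYPE('a) X" "\<not> padic_vanishes TYPE('a) X"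
  obtain b k where b: "b > 0" "\<And>n. n \<ge> k \<Longrightarrow> b < rat_padic_abs CARD('a) (X n)"
    using padic_cauchy_not_vanishes[OF X] by blast
  have nz: "X n \<noteq> 0" if "n \<ge> k" for n using b(1) b(2)[OF that] by auto
  have "padic_vanishes TYPE('a) (\<lambda>n. inverse (X n) * X n - 1)"
    by (rule padic_vanishes_bound[of "\<lambda>_. 0" _ 0])
      (use nz in \<open>auto simp: eventually_sequentially intro!: exI[of _ k]\<close>)
  thus "padic_vanishes TYPE('a)
      (\<lambda>n. (if padic_vanishes TYPE('a) X then \<lambda>_. 0 else (\<lambda>n. inverse (X n))) n * X n - 1)"
    using X by simp
qed

instantiation padic :: (prime_card) field
begin

lift_definition zero_padic :: "'a padic" is 0 .
lift_definition one_padic :: "'a padic" is 1 .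
lift_definition uminus_padic :: "'a padic \<Rightarrow> 'a padic" is uminus
  unfolding padic_rel_def by (metis minus_diff_minus padic_null_minus)
lift_definition plus_padic :: "'a padic \<Rightarrow> 'a padic \<Rightarrow> 'a padic" is "(+)"
  unfolding padic_rel_def by (metis add_diff_add padic_null_add)
lift_definition minus_padic :: "'a padic \<Rightarrow> 'a padic \<Rightarrow> 'a padic" is "(-)"
  unfolding padic_rel_def
  by (metis (no_types, lifting) add_diff_add diff_conv_add_uminus minus_diff_minus
      padic_null_add padic_null_minus)
lift_definition times_padic :: "'a padic \<Rightarrow> 'a padic \<Rightarrow> 'a padic" is "(*)"
proof -
  fix X X' Y Y' :: "'a padic_seq"
  assume "padic_rel X X'" "padic_rel Y Y'"
  hence "padic_null (Y' * (X - X') + X * (Y - Y'))"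
    unfolding padic_rel_def by (intro padic_null_add padic_null_mult)
  thus "padic_rel (X * Y) (X' * Y')" by (simp add: padic_rel_def algebra_simps)
qed
lift_definition inverse_padic :: "'a padic \<Rightarrow> 'a padic" is inverse_padic_seq
proof -
  fix X Y :: "'a padic_seq"
  assume *: "padic_rel X Y"
  hence "padic_null X \<longleftrightarrow> padic_null Y"
    unfolding padic_rel_def
    by (metis diff_add_cancel minus_diff_eq padic_null_add padic_null_minus)
  thus "padic_rel (inverse_padic_seq X) (inverse_padic_seq Y)"
    using * inverse_padic_seq_rel[of X Y]
    by (cases "padic_null X") (auto simp: padic_rel_def inverse_padic_seq_null)
qed

definition divide_padic :: "'a padic \<Rightarrow> 'a padic \<Rightarrow> 'a padic" where
  "divide_padic x y = x * inverse y"

instance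
proof
  fix a b c :: "'a padic"
  show "a + b = b + a" by transfer (simp add: padic_rel_def)
  show "(a + b) + c = a + (b + c)" by transfer (simp add: padic_rel_def)
  show "0 + a = a" by transfer (simp add: padic_rel_def)
  show "- a + a = 0" by transfer (simp add: padic_rel_def)
  show "a - b = a + - b" by transfer (simp add: padic_rel_def)
  show "(a * b) * c = a * (b * c)" by transfer (simp add: padic_rel_def algebra_simps)
  show "a * b = b * a" by transfer (simp add: padic_rel_def algebra_simps)
  show "1 * a = a" by transfer (simp add: padic_rel_def)
  show "(a + b) * c = a * c + b * c" by transfer (simp add: padic_rel_def algebra_simps)
  show "(0 :: 'a padic) \<noteq> 1"
    by transfer (metis diff_0 minus_minus padic_null_1 padic_null_minus padic_rel_def)
  show "a \<noteq> 0 \<Longrightarrow> inverse a * a = 1"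
    by transfer (simp add: padic_rel_def inverse_padic_seq_mult)
  show "a div b = a * inverse b" by (rule divide_padic_def)
  show "inverse (0 :: 'a padic) = 0"
    by transfer (simp add: padic_rel_def inverse_padic_seq_null)
qed

end

lift_definition padic_seq_abs :: "'p::prime_card padic_seq \<Rightarrow> real"
  is "\<lambda>X. lim (\<lambda>n. rat_padic_abs CARD('p) (X n))" .

lemma padic_seq_abs_LIMSEQ:
  fixes X :: "'p::prime_card padic_seq"
  shows "(\<lambda>n. rat_padic_abs CARD('p) (Rep_padic_seq X n)) \<longlonglongrightarrow> padic_seq_abs X"
  by transfer (use padic_cauchy_convergent convergent_LIMSEQ_iff in blast)

lemma padic_null_iff: "padic_null X \<longleftrightarrow> padic_seq_abs X = 0"
  using padic_seq_abs_LIMSEQ[of X] LIMSEQ_unique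
  by (fastforce simp: padic_null.rep_eq padic_vanishes_def)

lemma padic_seq_abs_triangle: "padic_seq_abs (X + Y) \<le> padic_seq_abs X + padic_seq_abs Y"
  by (rule LIMSEQ_le[OF padic_seq_abs_LIMSEQ tendsto_add[OF padic_seq_abs_LIMSEQ padic_seq_abs_LIMSEQ]])
    (auto simp: plus_padic_seq.rep_eq intro!: rat_padic_abs_triangle prime_card)

lemma padic_seq_abs_diff_commute: "padic_seq_abs (X - Y) = padic_seq_abs (Y - X)"
  by transfer (metis rat_padic_abs_diff_commute[OF prime_card])

text \<open>The \<open>p\<close>-adic absolute value on \<open>\<rat>\<^sub>p\<close>, normalized by \<open>\<bar>p\<bar> = 1/p\<close>: the continuous extension
  of the one on the rationals.\<close>

lift_definition padic_abs :: "'p::prime_card padic \<Rightarrow> real" is padic_seq_abs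
proof -
  fix X Y :: "'p padic_seq"
  assume "padic_rel X Y"
  hence "padic_seq_abs (X - Y) = 0" "padic_seq_abs (Y - X) = 0"
    by (simp_all add: padic_rel_def padic_null_iff padic_seq_abs_diff_commute[of Y X])
  thus "padic_seq_abs X = padic_seq_abs Y"
    using padic_seq_abs_triangle[of "X - Y" Y] padic_seq_abs_triangle[of "Y - X" X] by simp
qed

lemma padic_abs_eq_0_iff: "padic_abs x = 0 \<longleftrightarrow> x = 0"
  by transfer (simp add: padic_rel_def padic_null_iff)

lemma padic_abs_triangle: "padic_abs (x + y) \<le> padic_abs x + padic_abs y"
  by transfer (rule padic_seq_abs_triangle)

lemma padic_abs_diff_commute: "padic_abs (x - y) = padic_abs (y - x)"
  by transfer (rule padic_seq_abs_diff_commute)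

instantiation padic :: (prime_card) metric_space
begin

definition dist_padic :: "'a padic \<Rightarrow> 'a padic \<Rightarrow> real" where
  "dist_padic x y = padic_abs (x - y)"

definition uniformity_padic :: "('a padic \<times> 'a padic) filter" where
  "uniformity_padic = (INF e\<in>{0<..}. principal {(x, y). dist x y < e})"

definition open_padic :: "'a padic set \<Rightarrow> bool" where
  "open_padic U \<longleftrightarrow> (\<forall>x\<in>U. eventually (\<lambda>(x', y). x' = x \<longrightarrow> y \<in> U) uniformity)"

instance
proof
  fix x y z :: "'a padic"
  show "dist x y = 0 \<longleftrightarrow> x = y" by (simp add: dist_padic_def padic_abs_eq_0_iff)
  show "dist x y \<le> dist x z + dist y z"
    using padic_abs_triangle[of "x - z" "z - y"]
    by (simp add: dist_padic_def padic_abs_diff_commute[of y z])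
qed (simp_all add: uniformity_padic_def open_padic_def)

end

section \<open>Deformed ultrametrics and dilations\<close>

definition padic_norm :: "'p::prime_card padic ^ 'd \<Rightarrow> real" where
  "padic_norm x = (MAX l. padic_abs (x $ l))"

definition padic_integers :: "('p::prime_card padic ^ 'd) set" where
  "padic_integers = {x. \<forall>l. padic_abs (x $ l) \<le> 1}"

definition orthogonal_maps :: "('p::prime_card padic ^ 'd \<Rightarrow> 'p padic ^ 'd) set" where
  "orthogonal_maps =
     {U. Vector_Spaces.linear (*s) (*s) U \<and> (\<forall>x. padic_norm (U x) = padic_norm x)}"

definition deformed_ultrametric ::
    "('p::prime_card padic ^ 'd \<Rightarrow> 'p padic ^ 'd \<Rightarrow> real) \<Rightarrow> bool" where
  "deformed_ultrametric \<delta> \<longleftrightarrow>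
     (\<exists>q. \<exists>U\<in>orthogonal_maps.
        (\<forall>l. 1 / real CARD('p) < q l \<and> q l \<le> 1) \<and>
        (\<forall>x y. \<delta> x y = (MAX l. q l * padic_abs (U x $ l - U y $ l))))"

text \<open>Closed balls suffice: the nonzero values of a deformed ultrametric form a discrete subset of
  the positive reals, so that open and closed balls of positive radius are the same sets.\<close>

definition ball0 :: "('a::zero \<Rightarrow> 'a \<Rightarrow> real) \<Rightarrow> 'a set \<Rightarrow> bool" where
  "ball0 \<delta> B \<longleftrightarrow> (\<exists>r>0. B = {x. \<delta> 0 x \<le> r})"

definition maximal_subball0 :: "('a::zero \<Rightarrow> 'a \<Rightarrow> real) \<Rightarrow> 'a set \<Rightarrow> 'a set \<Rightarrow> bool" where
  "maximal_subball0 \<delta> B' B \<longleftrightarrow>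
     ball0 \<delta> B' \<and> B' \<subset> B \<and> \<not> (\<exists>C. ball0 \<delta> C \<and> B' \<subset> C \<and> C \<subset> B)"

definition dilation ::
    "('p::prime_card padic ^ 'd \<Rightarrow> 'p padic ^ 'd \<Rightarrow> real) \<Rightarrow> ('p padic ^ 'd \<Rightarrow> 'p padic ^ 'd) \<Rightarrow> bool"
  where
  "dilation \<delta> T \<longleftrightarrow>
     Vector_Spaces.linear (*s) (*s) T \<and> (\<forall>B. ball0 \<delta> B \<longrightarrow> maximal_subball0 \<delta> (T ` B) B)"

section \<open>Digits and the map from the p-adic to the real space\<close>

definition of_int_vec :: "int ^ 'd \<Rightarrow> 'a::ring_1 ^ 'd" where
  "of_int_vec v = (\<chi> i. of_int (v $ i))"

definition of_int_mat :: "int ^ 'd ^ 'd \<Rightarrow> 'a::ring_1 ^ 'd ^ 'd" where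
  "of_int_mat A = (\<chi> i j. of_int (A $ i $ j))"

text \<open>The power \<open>^\<close> of the library is entrywise on vectors and matrices.\<close>

definition mat_power_int :: "'a::field ^ 'd ^ 'd \<Rightarrow> int \<Rightarrow> 'a ^ 'd ^ 'd" where
  "mat_power_int M k =
     (((**) (if k \<ge> 0 then M else matrix_inv M)) ^^ nat \<bar>k\<bar>) (mat 1)"

definition digit_set :: "'p::prime_card itself \<Rightarrow> int ^ 'd ^ 'd \<Rightarrow> (int ^ 'd) set \<Rightarrow> bool" where
  "digit_set _ A D \<longleftrightarrow>
     card D = CARD('p) \<and>
     (\<forall>z \<in> (padic_integers :: ('p padic ^ 'd) set).
        \<exists>n\<in>D. z - of_int_vec n \<in> (*v) (of_int_mat A) ` padic_integers)"

text \<open>\<open>digit_map A D \<rho>\<close>: \<open>\<rho>\<close> is a well-defined map sending each \<open>\<Sum>i\<ge>\<gamma>. A\<^sup>i x\<^sub>i\<close> (in \<open>\<rat>\<^sub>p\<^sup>d\<close>) with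
  digits \<open>x\<^sub>i\<close> in \<open>D\<close> to \<open>\<Sum>i\<ge>\<gamma>. A\<^sup>-\<^sup>i\<^sup>-\<^sup>1 x\<^sub>i\<close> (in \<open>\<real>\<^sup>d\<close>). This includes convergence of the real
  series, and independence of the value from the chosen expansion (for instance, if \<open>0 \<notin> D\<close>, a
  point has expansions with different \<open>\<gamma>\<close>).\<close>

definition digit_map ::
    "int ^ 'd ^ 'd \<Rightarrow> (int ^ 'd) set \<Rightarrow> ('p::prime_card padic ^ 'd \<Rightarrow> real ^ 'd) \<Rightarrow> bool" where
  "digit_map A D \<rho> \<longleftrightarrow>
     (\<forall>(\<gamma>::int) x z. (\<forall>i\<ge>\<gamma>. x i \<in> D) \<longrightarrow>
        (\<lambda>n. mat_power_int (of_int_mat A) (\<gamma> + int n) *v of_int_vec (x (\<gamma> + int n))) sums z \<longrightarrow>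
        (\<lambda>n. mat_power_int (of_int_mat A) (- (\<gamma> + int n) - 1) *v of_int_vec (x (\<gamma> + int n)))
          sums \<rho> z)"

definition digit_tile :: "int ^ 'd ^ 'd \<Rightarrow> (int ^ 'd) set \<Rightarrow> (real ^ 'd) set" where
  "digit_tile A D =
     {y. \<exists>x. (\<forall>i. x i \<in> D) \<and>
        (\<lambda>i. mat_power_int (of_int_mat A) (- int i - 1) *v of_int_vec (x i)) sums y}"

section \<open>Haar measure and conservation of measure\<close>

definition padic_haar_measure :: "('p::prime_card padic ^ 'd) measure \<Rightarrow> bool" where
  "padic_haar_measure \<mu> \<longleftrightarrow>
     sets \<mu> = sets borel \<and>
     (\<forall>a. \<forall>E\<in>sets borel. emeasure \<mu> ((+) a ` E) = emeasure \<mu> E) \<and>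
     emeasure \<mu> padic_integers = 1"

definition conserves_measure ::
    "('p::prime_card padic ^ 'd) measure \<Rightarrow> ('p padic ^ 'd \<Rightarrow> real ^ 'd) \<Rightarrow> bool" where
  "conserves_measure \<mu> \<rho> \<longleftrightarrow>
     (\<forall>E\<in>sets \<mu>. \<rho> ` E \<in> sets lebesgue \<and> emeasure lebesgue (\<rho> ` E) = emeasure \<mu> E)"

end

theory Submission
  imports Defs
begin

text \<open>
Write \<open>p\<close> for the cardinality of the type parameter, \<open>Z\<close> for the integral p-adic vectors and \<open>R\<close> for
the tile.

Two evaluations of \<open>\<rho>\<close> carry the proof. The first is \<open>\<rho>(Z) = R\<close>
(\<open>digit_map_image_integers\<close>): a dilation makes the powers of \<open>A\<close> tend to zero uniformly on \<open>Z\<close>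
(\<open>dilation_contracting\<close>), so that the vectors of \<open>Z\<close> are exactly the sums of the series
\<open>\<Sum>i\<ge>0. A\<^sup>i x\<^sub>i\<close>. Hence \<open>R\<close> has measure one. The second is \<open>\<rho>(A\<^sup>-\<^sup>1 Z) = A R\<close>
(\<open>digit_map_image_inverse_image\<close>), because a shift of the index by one multiplies the p-adic series by
the inverse of \<open>A\<close> and the real one by \<open>A\<close>. The set \<open>A\<^sup>-\<^sup>1 Z\<close> is a disjoint union of \<open>p\<close> translates of
\<open>Z\<close> (\<open>haar_measure_inverse_image\<close>), and the real matrix scales Lebesgue measure by its determinant, so
\<open>\<bar>det A\<bar> = p\<close>. This is the second claim. It also turns the digits into a complete residue system of
the integral lattice modulo \<open>A\<close>: a p-adically integral solution of an integral system with
determinant \<open>\<plusminus>p\<close> is an integral vector (\<open>integral_preimage\<close>).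

The null intersections follow from measure one once the integral translates of \<open>R\<close> are known to cover
the space (\<open>covering_overlap_null\<close>): if a translate overlapped \<open>R\<close> in positive measure, then the
overlap could be removed from \<open>R\<close> without losing the covering, whereas a covering set has measure at
least one. For the covering (\<open>tile_translates_cover\<close>) the union of the translates is
invariant under the inverse of \<open>A\<close>, because the digits form a complete residue system. It is dense,
because the inverse powers of the real matrix tend to zero, and closed, because \<open>R\<close> is compact. Both
facts come from the convergence of all real digit series, which the existence of \<open>\<rho>\<close> entails
(\<open>inverse_powers_tendsto_0\<close>, which also uses the positive measure of \<open>R\<close>, and
\<open>compact_digit_series\<close>).
\<close>

section \<open>Absolute values of p-adic numbers\<close>

lemma rat_padic_abs_of_int:
  assumes "prime p" "z \<noteq> 0"
  shows "rat_padic_abs p (of_int z) = real p powi (- int (multiplicity (int p) z))"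
  using rat_padic_abs_divide[OF assms(1), of z 1] assms(2) by simp

lemma padic_seq_abs_mult: "padic_seq_abs (X * Y) = padic_seq_abs X * padic_seq_abs Y"
proof (rule LIMSEQ_unique[OF padic_seq_abs_LIMSEQ])
  show "(\<lambda>n. rat_padic_abs CARD('a) (Rep_padic_seq (X * Y) n))
      \<longlonglongrightarrow> padic_seq_abs X * padic_seq_abs Y"
    using tendsto_mult[OF padic_seq_abs_LIMSEQ[of X] padic_seq_abs_LIMSEQ[of Y]]
    by (simp add: times_padic_seq.rep_eq rat_padic_abs_mult[OF prime_card])
qed

lemma padic_abs_mult: "padic_abs (x * y) = padic_abs x * padic_abs y"
  by transfer (rule padic_seq_abs_mult)

lemma padic_seq_abs_add_le: "padic_seq_abs (X + Y) \<le> max (padic_seq_abs X) (padic_seq_abs Y)"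
  by (rule LIMSEQ_le[OF padic_seq_abs_LIMSEQ tendsto_max[OF padic_seq_abs_LIMSEQ padic_seq_abs_LIMSEQ]])
    (auto simp: plus_padic_seq.rep_eq intro!: rat_padic_abs_add_le prime_card)

lemma padic_abs_add_le: "padic_abs (x + y) \<le> max (padic_abs x) (padic_abs y)"
  by transfer (rule padic_seq_abs_add_le)

lemma padic_seq_abs_nonneg: "padic_seq_abs X \<ge> 0"
  by (rule LIMSEQ_le_const[OF padic_seq_abs_LIMSEQ]) (auto intro: rat_padic_abs_nonneg prime_card)

lemma padic_abs_nonneg [simp]: "padic_abs x \<ge> 0"
  by transfer (rule padic_seq_abs_nonneg)

lemma padic_abs_0 [simp]: "padic_abs 0 = 0"
  by (simp add: padic_abs_eq_0_iff)

lemma padic_abs_minus [simp]: "padic_abs (- x) = padic_abs x"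
  using padic_abs_diff_commute[of x 0] by simp

lemma padic_abs_diff_le: "padic_abs (x - y) \<le> max (padic_abs x) (padic_abs y)"
  using padic_abs_add_le[of x "- y"] by simp

lemma padic_abs_1 [simp]: "padic_abs (1 :: 'a::prime_card padic) = 1"
proof -
  have "padic_abs (1 :: 'a padic) * padic_abs (1 :: 'a padic) = padic_abs (1 :: 'a padic) * 1"
    using padic_abs_mult[of "1 :: 'a padic" 1] by simp
  moreover have "padic_abs (1 :: 'a padic) \<noteq> 0"
    by (simp add: padic_abs_eq_0_iff)
  ultimately show ?thesis by simp
qed

lemma padic_abs_inverse: "padic_abs (inverse x) = inverse (padic_abs x)"
proof (cases "x = 0")
  case False
  then have "padic_abs (inverse x) * padic_abs x = 1"
    by (simp flip: padic_abs_mult)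
  then show ?thesis
    by (metis inverse_unique mult.commute)
qed simp

lemma padic_abs_sum_le:
  assumes "finite S" "\<And>i. i \<in> S \<Longrightarrow> padic_abs (f i) \<le> c" "0 \<le> c"
  shows "padic_abs (sum f S) \<le> c"
  using assms
proof (induction S rule: finite_induct)
  case (insert i S)
  then show ?case
    using padic_abs_add_le[of "f i" "sum f S"] by (simp add: order_trans)
qed simp

lemma padic_abs_abs_padic_seq: "padic_abs (abs_padic X) = padic_seq_abs X"
  by (rule padic_abs.abs_eq)

lemma Rep_padic_seq_of_int: "Rep_padic_seq (of_int z) = (\<lambda>_. of_int z)"
proof (induction z rule: int_induct[where k = 0])
  case (step1 i)
  then show ?case by (simp add: plus_padic_seq.rep_eq one_padic_seq.rep_eq)
next
  case (step2 i)
  then show ?case by (simp add: minus_padic_seq.rep_eq one_padic_seq.rep_eq)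
qed (simp add: zero_padic_seq.rep_eq)

lemma of_int_padic: "(of_int z :: 'p::prime_card padic) = abs_padic (of_int z)"
proof (induction z rule: int_induct[where k = 0])
  case base
  then show ?case by (simp add: zero_padic.abs_eq)
next
  case (step1 i)
  then show ?case by (simp add: plus_padic.abs_eq one_padic.abs_eq)
next
  case (step2 i)
  then show ?case by (simp add: minus_padic.abs_eq one_padic.abs_eq)
qed

lemma padic_abs_of_int: "padic_abs (of_int z :: 'p::prime_card padic) = rat_padic_abs CARD('p) (of_int z)"
  unfolding of_int_padic padic_abs_abs_padic_seq
  by (rule LIMSEQ_unique[OF padic_seq_abs_LIMSEQ]) (simp add: Rep_padic_seq_of_int)

lemma CARD_prime_card_gt_1: "CARD('p::prime_card) > 1"
  by (rule prime_gt_1_nat[OF prime_card])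

lemma padic_abs_of_int_powi:
  "z \<noteq> 0 \<Longrightarrow> padic_abs (of_int z :: 'p::prime_card padic)
      = real CARD('p) powi (- int (multiplicity (int CARD('p)) z))"
  by (simp add: padic_abs_of_int rat_padic_abs_of_int prime_card)

lemma of_int_padic_eq_0_iff [simp]: "(of_int z :: 'p::prime_card padic) = 0 \<longleftrightarrow> z = 0"
  using padic_abs_of_int_powi[of z, where 'p='p] CARD_prime_card_gt_1[where 'p='p]
  by (cases "z = 0") (auto simp: padic_abs_eq_0_iff[symmetric] simp del: of_int_eq_0_iff)

lemma padic_abs_of_int_le_1 [simp]: "padic_abs (of_int z :: 'p::prime_card padic) \<le> 1"
  using CARD_prime_card_gt_1[where 'p='p]
  by (cases "z = 0") (auto simp: padic_abs_of_int_powi power_int_minus intro!: inverse_le_1_iff[THEN iffD2])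

lemma padic_abs_of_int_less_1_iff:
  "padic_abs (of_int z :: 'p::prime_card padic) < 1 \<longleftrightarrow> int CARD('p) dvd z"
proof (cases "z = 0")
  case False
  define m where "m = multiplicity (int CARD('p)) z"
  have p: "real CARD('p) > 1"
    using CARD_prime_card_gt_1[where 'p='p] by simp
  have "padic_abs (of_int z :: 'p padic) = inverse (real CARD('p) ^ m)"
    using False by (simp add: padic_abs_of_int_powi power_int_minus m_def)
  moreover have "inverse (real CARD('p) ^ m) < 1 \<longleftrightarrow> m > 0"
    using p one_less_power[of "real CARD('p)" m] by (cases "m = 0") (simp_all add: inverse_less_1_iff)
  moreover have "m > 0 \<longleftrightarrow> int CARD('p) dvd z"
    using False CARD_prime_card_gt_1[where 'p='p]
    unfolding m_def by (subst multiplicity_gt_zero_iff) (auto simp: zdvd1_eq)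
  ultimately show ?thesis by simp
qed simp

lemma padic_abs_CARD: "padic_abs (of_int (int CARD('p)) :: 'p::prime_card padic) = 1 / real CARD('p)"
proof -
  have "multiplicity (int CARD('p)) (int CARD('p)) = 1"
    using CARD_prime_card_gt_1[where 'p='p] by (intro multiplicity_self) (auto simp: zdvd1_eq)
  then show ?thesis
    using CARD_prime_card_gt_1[where 'p='p]
    by (subst padic_abs_of_int_powi) (auto simp: power_int_minus divide_inverse)
qed

text \<open>The absolute value of a nonzero p-adic number is attained along every representing Cauchy
  sequence from some index on, by the ultrametric inequality; hence the value group is that of the
  rationals.\<close>

lemma padic_abs_powi:
  fixes x :: "'p::prime_card padic"
  assumes "x \<noteq> 0"
  obtains k where "padic_abs x = real CARD('p) powi k"
proof -
  obtain X where x: "x = abs_padic X"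
    by (metis Quotient_abs_rep[OF Quotient_padic])
  let ?X = "Rep_padic_seq X"
  have lim: "(\<lambda>n. rat_padic_abs CARD('p) (?X n)) \<longlonglongrightarrow> padic_abs x"
    unfolding x padic_abs_abs_padic_seq by (rule padic_seq_abs_LIMSEQ)
  have X: "padic_cauchy TYPE('p) ?X"
    using Rep_padic_seq[of X] by simp
  have "padic_abs x > 0"
    using assms padic_abs_nonneg[of x] by (simp add: less_le padic_abs_eq_0_iff)
  then have "\<not> padic_vanishes TYPE('p) ?X"
    using LIMSEQ_unique[OF lim, of 0] by (auto simp: padic_vanishes_def)
  then obtain b k where b: "b > 0" "\<And>n. n \<ge> k \<Longrightarrow> b < rat_padic_abs CARD('p) (?X n)"
    using padic_cauchy_not_vanishes[OF X] by blast
  obtain l where l: "\<And>m n. m \<ge> l \<Longrightarrow> n \<ge> l \<Longrightarrow> rat_padic_abs CARD('p) (?X m - ?X n) < b"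
    using X b(1) unfolding padic_cauchy_def by blast
  define N where "N = max k l"
  have le: "rat_padic_abs CARD('p) (?X m) \<le> rat_padic_abs CARD('p) (?X n)"
    if "m \<ge> N" "n \<ge> N" for m n
    using rat_padic_abs_add_le[OF prime_card[where 'a='p], of "?X m - ?X n" "?X n"]
      l[of m n] b(2)[of n] that by (simp add: N_def)
  have "(\<lambda>n. rat_padic_abs CARD('p) (?X n)) \<longlonglongrightarrow> rat_padic_abs CARD('p) (?X N)"
    using le by (intro tendsto_eventually eventually_sequentiallyI[of N] antisym) auto
  then have "padic_abs x = rat_padic_abs CARD('p) (?X N)"
    using lim LIMSEQ_unique by blast
  moreover have "?X N \<noteq> 0"
    using b(2)[of N] b(1) by (auto simp: N_def)
  ultimately show thesis
    using that by (simp add: rat_padic_abs_def)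
qed

lemma padic_abs_eq_1I:
  fixes x :: "'p::prime_card padic"
  assumes "1 / real CARD('p) < padic_abs x" "padic_abs x < real CARD('p)"
  shows "padic_abs x = 1"
proof -
  have p: "real CARD('p) > 1"
    using CARD_prime_card_gt_1[where 'p='p] by simp
  have "x \<noteq> 0"
    using assms(1) p by (auto simp: divide_less_0_iff)
  then obtain k where k: "padic_abs x = real CARD('p) powi k"
    by (rule padic_abs_powi)
  have "real CARD('p) powi (-1) < real CARD('p) powi k" "real CARD('p) powi k < real CARD('p) powi 1"
    using assms k by (simp_all add: power_int_minus divide_inverse)
  then have "-1 < k" "k < 1"
    using p power_int_increasing[of k "-1" "real CARD('p)"] power_int_increasing[of 1 k "real CARD('p)"] by force+
  then have "k = 0" by simp
  then show ?thesis
    using k by simp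
qed

text \<open>Enough of the completeness of the field for sums of digits, whose partial sums are
  integral: the sequence itself represents its limit.\<close>

lemma padic_cauchy_of_int_convergent:
  fixes X :: "nat \<Rightarrow> int"
  assumes "\<And>r. r > 0 \<Longrightarrow> \<exists>k. \<forall>m\<ge>k. \<forall>n\<ge>k. padic_abs (of_int (X m - X n) :: 'p::prime_card padic) < r"
  obtains x :: "'p::prime_card padic" where "(\<lambda>n. padic_abs (of_int (X n) - x)) \<longlonglongrightarrow> 0"
proof -
  have X: "padic_cauchy TYPE('p) (\<lambda>n. of_int (X n))"
    using assms unfolding padic_cauchy_def padic_abs_of_int by simp
  define Y :: "'p padic_seq" where "Y = Abs_padic_seq (\<lambda>n. of_int (X n))"
  have Y: "Rep_padic_seq Y = (\<lambda>n. of_int (X n))"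
    unfolding Y_def using X by (simp add: Abs_padic_seq_inverse)
  have lim: "(\<lambda>m. rat_padic_abs CARD('p) (of_int (X n - X m))) \<longlonglongrightarrow> padic_abs (of_int (X n) - abs_padic Y)" for n
    using padic_seq_abs_LIMSEQ[of "of_int (X n) - Y"]
    by (simp add: of_int_padic minus_padic.abs_eq padic_abs_abs_padic_seq minus_padic_seq.rep_eq
        Rep_padic_seq_of_int Y)
  have "(\<lambda>n. padic_abs (of_int (X n) - abs_padic Y)) \<longlonglongrightarrow> 0"
  proof (rule LIMSEQ_I)
    fix r :: real assume "r > 0"
    then obtain k where k: "\<And>m n. m \<ge> k \<Longrightarrow> n \<ge> k \<Longrightarrow> rat_padic_abs CARD('p) (of_int (X m - X n)) < r / 2"
      using assms[of "r / 2"] unfolding padic_abs_of_int by auto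
    have "padic_abs (of_int (X n) - abs_padic Y) \<le> r / 2" if "n \<ge> k" for n
      using k that by (intro LIMSEQ_le_const2[OF lim[of n]]) (auto intro: less_imp_le)
    then show "\<exists>k. \<forall>n\<ge>k. norm (padic_abs (of_int (X n) - abs_padic Y) - 0) < r"
      using \<open>r > 0\<close> by (intro exI[of _ k]) (simp add: le_less_trans[of _ "r / 2" r])
  qed
  then show thesis
    by (rule that)
qed

section \<open>Integer matrices and their powers\<close>

lemma of_int_vec_nth [simp]: "of_int_vec v $ i = of_int (v $ i)"
  by (simp add: of_int_vec_def)

lemma of_int_mat_nth [simp]: "of_int_mat M $ i $ j = of_int (M $ i $ j)"
  by (simp add: of_int_mat_def)

lemma of_int_vec_diff: "of_int_vec (v - w) = of_int_vec v - of_int_vec w"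
  by (simp add: vec_eq_iff)

lemma of_int_vec_add: "of_int_vec (v + w) = of_int_vec v + of_int_vec w"
  by (simp add: vec_eq_iff)

lemma of_int_mat_mult_of_int_vec: "of_int_mat M *v of_int_vec v = of_int_vec (M *v v)"
  by (simp add: vec_eq_iff matrix_vector_mult_def)

lemma funpow_of_int_mat:
  "((*v) (of_int_mat M) ^^ n) (of_int_vec v) = of_int_vec (((*v) M ^^ n) v)"
  by (induction n) (simp_all add: of_int_mat_mult_of_int_vec)

lemma det_of_int_mat: "det (of_int_mat M :: 'a::comm_ring_1 ^ 'n ^ 'n) = of_int (det M)"
  by (simp add: det_def of_int_mat_def)

lemma matrix_inv_cancel:
  fixes M :: "'a::field ^ 'n ^ 'n"
  assumes "det M \<noteq> 0"
  shows "M *v (matrix_inv M *v x) = x" "matrix_inv M *v (M *v x) = x"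
proof -
  have "\<exists>M'. M ** M' = mat 1 \<and> M' ** M = mat 1"
    using assms invertible_det_nz[of M] by (simp add: invertible_def)
  then have "M ** matrix_inv M = mat 1" "matrix_inv M ** M = mat 1"
    unfolding matrix_inv_def by (metis (mono_tags, lifting) someI_ex)+
  then show "M *v (matrix_inv M *v x) = x" "matrix_inv M *v (M *v x) = x"
    by (simp_all add: matrix_vector_mul_assoc)
qed

lemma mat_power_mult_vec:
  fixes M :: "'a::field ^ 'n ^ 'n"
  shows "(((**) M) ^^ n) (mat 1) *v x = ((*v) M ^^ n) x"
  by (induction n) (simp_all add: matrix_vector_mul_assoc[symmetric])

lemma mat_power_int_of_nat: "mat_power_int M (int n) *v x = ((*v) M ^^ n) x"
  by (simp add: mat_power_int_def mat_power_mult_vec)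

lemma mat_power_int_minus_of_nat: "mat_power_int M (- int n) *v x = ((*v) (matrix_inv M) ^^ n) x"
  by (cases "n = 0") (simp_all add: mat_power_int_def mat_power_mult_vec)

lemma funpow_mult_add:
  fixes M :: "'a::comm_ring_1 ^ 'n ^ 'n"
  shows "((*v) M ^^ n) (x + y) = ((*v) M ^^ n) x + ((*v) M ^^ n) y"
  by (induction n) (simp_all add: matrix_vector_right_distrib)

lemma funpow_mult_scale:
  fixes M :: "'a::field ^ 'n ^ 'n"
  shows "((*v) M ^^ n) (c *s x) = c *s ((*v) M ^^ n) x"
  by (induction n) (simp_all add: vector_scalar_commute)

section \<open>The lattice of integral vectors\<close>

lemma padic_integersI: "(\<And>l. padic_abs (x $ l) \<le> 1) \<Longrightarrow> x \<in> padic_integers"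
  by (simp add: padic_integers_def)

lemma padic_integersD: "x \<in> padic_integers \<Longrightarrow> padic_abs (x $ l) \<le> 1"
  by (simp add: padic_integers_def)

lemma padic_integers_add: "x \<in> padic_integers \<Longrightarrow> y \<in> padic_integers \<Longrightarrow> x + y \<in> padic_integers"
  using padic_abs_add_le order_trans by (fastforce simp: padic_integers_def)

lemma padic_integers_diff: "x \<in> padic_integers \<Longrightarrow> y \<in> padic_integers \<Longrightarrow> x - y \<in> padic_integers"
  using padic_abs_diff_le order_trans by (fastforce simp: padic_integers_def)

lemma padic_integers_scale:
  "padic_abs c \<le> 1 \<Longrightarrow> x \<in> padic_integers \<Longrightarrow> c *s x \<in> padic_integers"
  by (auto simp: padic_integers_def padic_abs_mult mult_le_one)

lemma of_int_vec_padic_integers [simp]: "of_int_vec v \<in> padic_integers"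
  by (rule padic_integersI) simp

lemma of_int_mat_padic_integers: "x \<in> padic_integers \<Longrightarrow> of_int_mat M *v x \<in> padic_integers"
  by (rule padic_integersI)
    (auto simp: matrix_vector_mult_def padic_abs_mult padic_integersD intro!: padic_abs_sum_le mult_le_one)

lemma funpow_of_int_mat_padic_integers:
  "x \<in> padic_integers \<Longrightarrow> ((*v) (of_int_mat M) ^^ n) x \<in> padic_integers"
  by (induction n) (simp_all add: of_int_mat_padic_integers)

lemma padic_vec_tendsto_iff:
  fixes z :: "'p::prime_card padic ^ 'd"
  shows "(f \<longlongrightarrow> z) F \<longleftrightarrow> (\<forall>l. ((\<lambda>n. padic_abs (f n $ l - z $ l)) \<longlongrightarrow> 0) F)"
proof -
  have "(f \<longlongrightarrow> z) F \<longleftrightarrow> (\<forall>l. ((\<lambda>n. f n $ l) \<longlongrightarrow> z $ l) F)"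
    by (auto intro: vec_tendstoI tendsto_vec_nth)
  then show ?thesis
    by (simp add: tendsto_dist_iff[of _ "z $ _"] dist_padic_def)
qed

lemma padic_matrix_mult_tendsto:
  fixes M :: "'p::prime_card padic ^ 'd ^ 'd"
  assumes "(f \<longlongrightarrow> z) F"
  shows "((\<lambda>n. M *v f n) \<longlongrightarrow> M *v z) F"
  unfolding padic_vec_tendsto_iff
proof
  fix l
  let ?g = "\<lambda>n. \<Sum>j\<in>UNIV. padic_abs (M $ l $ j) * padic_abs (f n $ j - z $ j)"
  have "(?g \<longlongrightarrow> (\<Sum>j\<in>UNIV. padic_abs (M $ l $ j) * 0)) F"
    using assms by (intro tendsto_intros) (simp add: padic_vec_tendsto_iff)
  then have g: "(?g \<longlongrightarrow> 0) F" by simp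
  have "padic_abs ((M *v f n) $ l - (M *v z) $ l) \<le> ?g n" for n
  proof -
    have "(M *v f n) $ l - (M *v z) $ l = (\<Sum>j\<in>UNIV. M $ l $ j * (f n $ j - z $ j))"
      by (simp add: matrix_vector_mult_def right_diff_distrib sum_subtractf)
    moreover have "padic_abs (M $ l $ j * (f n $ j - z $ j)) \<le> ?g n" for j
      unfolding padic_abs_mult by (rule member_le_sum) auto
    ultimately show ?thesis
      by (simp add: padic_abs_sum_le sum_nonneg)
  qed
  then show "((\<lambda>n. padic_abs ((M *v f n) $ l - (M *v z) $ l)) \<longlongrightarrow> 0) F"
    by (intro tendsto_sandwich[OF _ _ tendsto_const g]) auto
qed

lemma padic_norm_le_iff: "padic_norm x \<le> c \<longleftrightarrow> (\<forall>l. padic_abs (x $ l) \<le> c)"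
  by (simp add: padic_norm_def)

section \<open>Dilations contract the integral vectors\<close>

text \<open>The length of every nonzero vector drops under a dilation, since the ball whose radius is this
  length is mapped into a smaller ball. A deformed length between \<open>1/p\<close> and \<open>1\<close> is one of the
  weights, so that \<open>d\<close> steps suffice to leave this range.\<close>

lemma dilation_funpow_le:
  fixes \<delta> :: "'p::prime_card padic ^ 'd \<Rightarrow> 'p padic ^ 'd \<Rightarrow> real"
  assumes def: "deformed_ultrametric \<delta>" and dil: "dilation \<delta> T" and x: "x \<in> padic_integers"
  shows "padic_abs ((T ^^ CARD('d)) x $ l) \<le> 1 / real CARD('p)"
proof (rule ccontr)
  assume contra: "\<not> ?thesis"
  obtain q U where "U \<in> orthogonal_maps" and wts: "\<forall>l. 1 / real CARD('p) < q l \<and> q l \<le> 1"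
    and \<delta>: "\<forall>x y. \<delta> x y = (MAX l. q l * padic_abs (U x $ l - U y $ l))"
    using def unfolding deformed_ultrametric_def by blast
  then have U: "Vector_Spaces.linear (*s) (*s) U" "\<And>x. padic_norm (U x) = padic_norm x"
    by (auto simp: orthogonal_maps_def)
  have q: "1 / real CARD('p) < q l" "q l \<le> 1" for l
    using wts by auto
  have p: "real CARD('p) > 1"
    using CARD_prime_card_gt_1[where 'p='p] by simp
  have q0: "q l > 0" for l
    using q(1)[of l] p by (smt (verit) divide_pos_pos)
  define N where "N = \<delta> 0"
  interpret U: Vector_Spaces.linear "(*s)" "(*s)" U by (fact U(1))
  interpret T: Vector_Spaces.linear "(*s)" "(*s)" T using dil by (simp add: dilation_def)
  have N: "N x = (MAX l. q l * padic_abs (U x $ l))" for x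
    by (simp add: N_def \<delta> U.zero)
  have N_le: "N x \<le> r \<longleftrightarrow> (\<forall>l. q l * padic_abs (U x $ l) \<le> r)" for x r
    by (simp add: N)
  have N_attained: "\<exists>l. N x = q l * padic_abs (U x $ l)" for x
  proof -
    have "N x \<in> range (\<lambda>l. q l * padic_abs (U x $ l))"
      unfolding N by (rule Max_in) auto
    then show ?thesis by auto
  qed
  have U_le: "(\<forall>l. padic_abs (U x $ l) \<le> c) \<longleftrightarrow> (\<forall>l. padic_abs (x $ l) \<le> c)" for x c
    using padic_norm_le_iff[of "U x" c] padic_norm_le_iff[of x c] U(2)[of x] by simp
  have N_pos: "N x > 0" if "x \<noteq> 0" for x
  proof -
    have "\<not> (\<forall>l. padic_abs (x $ l) \<le> 0)"
      using that padic_abs_nonneg antisym padic_abs_eq_0_iff by (metis vec_eq_iff zero_index)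
    then have "\<exists>l. padic_abs (U x $ l) > 0"
      by (simp only: U_le[of x 0, symmetric] not_all not_le)
    then obtain l where "padic_abs (U x $ l) > 0" ..
    then have "\<not> N x \<le> 0"
      unfolding N_le using q0[of l] by (auto simp: not_le intro!: exI[of _ l])
    then show ?thesis by simp
  qed
  \<comment> \<open>Compare with the ball whose radius is the length of \<open>x\<close> itself.\<close>
  have step: "N (T x) < N x" if "x \<noteq> 0" for x
  proof (rule ccontr)
    assume *: "\<not> N (T x) < N x"
    let ?B = "{y. N y \<le> N x}"
    have "ball0 \<delta> ?B"
      unfolding ball0_def N_def[symmetric] using N_pos[OF that] by blast
    then have "maximal_subball0 \<delta> (T ` ?B) ?B"
      using dil by (simp add: dilation_def)
    then obtain r where r: "T ` ?B = {y. N y \<le> r}" and sub: "T ` ?B \<subset> ?B"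
      unfolding maximal_subball0_def ball0_def N_def by blast
    have "T x \<in> T ` ?B" by simp
    then have "N (T x) \<le> r" using r by blast
    then have "?B \<subseteq> T ` ?B" using * r by auto
    then show False using sub by blast
  qed
  let ?y = "\<lambda>j. (T ^^ j) x"
  let ?d = "CARD('d)"
  have T0: "(T ^^ n) 0 = 0" for n
    by (induction n) (simp_all add: T.zero)
  have nz: "?y j \<noteq> 0" if "j \<le> ?d" for j
  proof
    assume "?y j = 0"
    then have "?y ?d = 0"
      using that T0[of "?d - j"] funpow_add[of "?d - j" j T] by simp
    then show False using contra p by simp
  qed
  have decr: "N (?y j) < N (?y i)" if "i < j" "j \<le> ?d" for i j
    using that
  proof (induction j)
    case (Suc j)
    have "N (?y (Suc j)) < N (?y j)"
      using step[OF nz[of j]] Suc.prems by simp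
    then show ?case
      using Suc by (cases "i = j") auto
  qed simp
  have "N x \<le> 1"
    unfolding N_le using U_le[of x 1] x q(2) less_imp_le[OF q0]
    by (auto simp: padic_integers_def intro!: mult_le_one)
  then have upper: "N (?y j) \<le> 1" if "j \<le> ?d" for j
    using decr[of 0 j] that by (cases "j = 0") auto
  have "\<exists>l. 1 / real CARD('p) < padic_abs (U (?y ?d) $ l)"
    using contra U_le[of "?y ?d" "1 / real CARD('p)"] by (meson not_le)
  then obtain k where k: "1 / real CARD('p) < padic_abs (U (?y ?d) $ k)" by blast
  then have "1 \<le> padic_abs (U (?y ?d) $ k)"
    using padic_abs_eq_1I[OF k] p by linarith
  then have "q k * 1 \<le> q k * padic_abs (U (?y ?d) $ k)"
    using q0[of k] by (intro mult_left_mono) auto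
  also have "\<dots> \<le> N (?y ?d)"
    using N_le[of "?y ?d" "N (?y ?d)"] by blast
  finally have "1 / real CARD('p) < N (?y ?d)"
    using q(1)[of k] by simp
  then have lower: "1 / real CARD('p) < N (?y j)" if "j \<le> ?d" for j
    using decr[of j ?d] that by (cases "j = ?d") auto
  \<comment> \<open>The weight is at most one and exceeds \<open>1/p\<close>, so the absolute value lies strictly between \<open>1/p\<close>
    and \<open>p\<close>, where the value group contains only one.\<close>
  have "N (?y j) \<in> range q" if j: "j \<le> ?d" for j
  proof -
    obtain l where l: "N (?y j) = q l * padic_abs (U (?y j) $ l)"
      using N_attained by blast
    let ?u = "padic_abs (U (?y j) $ l)"
    have "1 / real CARD('p) * 1 < q l * ?u" "q l * ?u \<le> 1"
      using lower[OF j] upper[OF j] l by auto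
    moreover have "q l * ?u \<le> 1 * ?u"
      using q(2) by (intro mult_right_mono) auto
    moreover have "?u < real CARD('p)"
    proof (rule ccontr)
      assume "\<not> ?thesis"
      then have "q l * real CARD('p) \<le> q l * ?u"
        using q0[of l] by (intro mult_left_mono) auto
      moreover have "1 < q l * real CARD('p)"
        using q(1)[of l] p by (simp add: field_simps)
      ultimately show False using \<open>q l * ?u \<le> 1\<close> by linarith
    qed
    ultimately have "?u = 1"
      by (intro padic_abs_eq_1I) auto
    then show ?thesis using l by simp
  qed
  then have "(\<lambda>j. N (?y j)) ` {..?d} \<subseteq> range q" by auto
  then have "card ((\<lambda>j. N (?y j)) ` {..?d}) \<le> card (range q)"
    by (intro card_mono) auto
  moreover have "card (range q) \<le> ?d" by (rule card_image_le) simp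
  moreover have "inj_on (\<lambda>j. N (?y j)) {..?d}"
    by (rule linorder_inj_onI') (use decr in \<open>metis atMost_iff less_irrefl\<close>)
  ultimately show False by (simp add: card_image)
qed

text \<open>The property of a dilation from which the digit expansions are derived.\<close>

definition contracting :: "('p::prime_card padic ^ 'd \<Rightarrow> 'p padic ^ 'd) \<Rightarrow> bool" where
  "contracting T \<longleftrightarrow>
     (\<exists>c. c \<longlonglongrightarrow> 0 \<and> (\<forall>n. \<forall>x\<in>padic_integers. \<forall>l. padic_abs ((T ^^ n) x $ l) \<le> c n))"

lemma dilation_contracting:
  fixes \<delta> :: "'p::prime_card padic ^ 'd \<Rightarrow> 'p padic ^ 'd \<Rightarrow> real"
  assumes "deformed_ultrametric \<delta>" "dilation \<delta> ((*v) (of_int_mat A))"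
  shows "contracting ((*v) (of_int_mat A) :: 'p padic ^ 'd \<Rightarrow> _)"
  unfolding contracting_def
proof (intro exI conjI allI ballI)
  let ?T = "(*v) (of_int_mat A) :: 'p padic ^ 'd \<Rightarrow> 'p padic ^ 'd"
  let ?p = "real CARD('p)" and ?d = "CARD('d)"
  have p: "?p > 1"
    using CARD_prime_card_gt_1[where 'p='p] by simp
  \<comment> \<open>Each block of \<open>d\<close> steps gains a factor \<open>1/p\<close>; linearity lets us rescale after a block.\<close>
  have iter: "padic_abs ((?T ^^ (?d * k)) x $ l) \<le> (1 / ?p) ^ k" if "x \<in> padic_integers" for x k l
  proof (induction k arbitrary: l)
    case 0
    then show ?case using that by (simp add: padic_integersD)
  next
    case (Suc k)
    define c :: "'p padic" where "c = of_int (int CARD('p)) ^ k"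
    have c: "padic_abs c = (1 / ?p) ^ k"
      unfolding c_def by (induction k) (simp_all add: padic_abs_mult padic_abs_CARD del: of_int_of_nat_eq)
    have "padic_abs c > 0" using p c by simp
    then have c0: "c \<noteq> 0" by auto
    define y where "y = (?T ^^ (?d * k)) x"
    define z where "z = inverse c *s y"
    have "padic_abs (y $ l) \<le> padic_abs c" for l
      unfolding y_def c by (rule Suc.IH)
    moreover have "padic_abs (z $ l) = padic_abs (y $ l) / padic_abs c" for l
      by (simp add: z_def padic_abs_mult padic_abs_inverse divide_inverse mult.commute)
    ultimately have z: "z \<in> padic_integers"
      using \<open>padic_abs c > 0\<close> by (intro padic_integersI) simp
    have "(?T ^^ (?d * Suc k)) x = (?T ^^ ?d) y"
      by (simp add: y_def flip: funpow_add[unfolded comp_def, THEN fun_cong])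
    also have "y = c *s z"
      using c0 by (simp add: z_def)
    finally have "padic_abs ((?T ^^ (?d * Suc k)) x $ l) = padic_abs c * padic_abs ((?T ^^ ?d) z $ l)"
      by (simp add: funpow_mult_scale padic_abs_mult)
    also have "\<dots> \<le> padic_abs c * (1 / ?p)"
      by (intro mult_left_mono dilation_funpow_le[OF assms z]) simp
    finally show ?case by (simp add: c)
  qed
  show "(\<lambda>n. (1 / ?p) ^ (n div ?d)) \<longlonglongrightarrow> 0"
    using p by (intro filterlim_compose[OF LIMSEQ_power_zero] filterlim_at_top_div_const_nat) auto
  fix n x l
  assume x: "(x :: 'p padic ^ 'd) \<in> padic_integers"
  have "(?T ^^ n) x = (?T ^^ (?d * (n div ?d))) ((?T ^^ (n mod ?d)) x)"
    using funpow_add[of "?d * (n div ?d)" "n mod ?d" ?T] by simp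
  then show "padic_abs ((?T ^^ n) x $ l) \<le> (1 / ?p) ^ (n div ?d)"
    using iter[OF funpow_of_int_mat_padic_integers[OF x]] by simp
qed

section \<open>Digit expansions of p-adic vectors\<close>

lemma digit_setD:
  assumes "digit_set TYPE('p::prime_card) A D" "(z :: 'p padic ^ 'd) \<in> padic_integers"
  obtains n w where "n \<in> D" "w \<in> (padic_integers :: ('p padic ^ 'd) set)"
    "z = of_int_vec n + of_int_mat A *v w"
proof -
  obtain n where n: "n \<in> D"
    and "z - of_int_vec n \<in> (*v) (of_int_mat A) ` (padic_integers :: ('p padic ^ 'd) set)"
    using assms unfolding digit_set_def by blast
  then obtain w where w: "w \<in> (padic_integers :: ('p padic ^ 'd) set)"
    "z - of_int_vec n = of_int_mat A *v w"
    by blast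
  then have "z = of_int_vec n + of_int_mat A *v w"
    by (metis add.commute diff_add_cancel)
  then show thesis
    using that n w by blast
qed

text \<open>Repeated division by the matrix produces the digits as remainders; after \<open>n\<close> steps the error is
  the \<open>n\<close>-th power applied to an integral quotient, which contraction makes small.\<close>

lemma digit_expansion_exists:
  fixes A :: "int ^ 'd ^ 'd" and z :: "'p::prime_card padic ^ 'd"
  defines "T \<equiv> (*v) (of_int_mat A) :: 'p padic ^ 'd \<Rightarrow> 'p padic ^ 'd"
  assumes con: "contracting T" and D: "digit_set TYPE('p) A D" and z: "z \<in> padic_integers"
  obtains x where "\<And>i. x i \<in> D" "(\<lambda>i. (T ^^ i) (of_int_vec (x i))) sums z"
proof -
  have "\<exists>n w. n \<in> D \<and> w \<in> padic_integers \<and> u = of_int_vec n + T w"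
    if "u \<in> padic_integers" for u :: "'p padic ^ 'd"
    using digit_setD[OF D that] unfolding T_def by metis
  then obtain dig quo where dq: "\<And>u. u \<in> padic_integers \<Longrightarrow> dig u \<in> D"
      "\<And>u. u \<in> padic_integers \<Longrightarrow> quo u \<in> padic_integers"
      "\<And>u. u \<in> padic_integers \<Longrightarrow> u = of_int_vec (dig u) + T (quo u)"
    by metis
  define r where "r i = (quo ^^ i) z" for i
  have r: "r i \<in> padic_integers" for i
    by (induction i) (simp_all add: r_def z dq(2))
  have r_Suc: "r i = of_int_vec (dig (r i)) + T (r (Suc i))" for i
    using dq(3)[OF r[of i]] by (simp add: r_def)
  have remainder: "z = (\<Sum>i<n. (T ^^ i) (of_int_vec (dig (r i)))) + (T ^^ n) (r n)" for n
  proof (induction n)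
    case (Suc n)
    have "(T ^^ n) (r n) = (T ^^ n) (of_int_vec (dig (r n))) + (T ^^ Suc n) (r (Suc n))"
      by (subst r_Suc) (simp add: T_def funpow_mult_add funpow_swap1)
    then show ?case
      using Suc by (simp add: add.assoc)
  qed (simp add: r_def)
  obtain c where c: "c \<longlonglongrightarrow> 0" "\<And>n x l. x \<in> padic_integers \<Longrightarrow> padic_abs ((T ^^ n) x $ l) \<le> c n"
    using con unfolding contracting_def by blast
  have "(\<lambda>i. (T ^^ i) (of_int_vec (dig (r i)))) sums z"
    unfolding sums_def padic_vec_tendsto_iff
  proof
    fix l
    have "padic_abs ((\<Sum>i<n. (T ^^ i) (of_int_vec (dig (r i)))) $ l - z $ l) \<le> c n" for n
    proof -
      have "(\<Sum>i<n. (T ^^ i) (of_int_vec (dig (r i)))) $ l - z $ l = - ((T ^^ n) (r n) $ l)"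
        using arg_cong[OF remainder[of n], of "\<lambda>v. v $ l"] by (simp add: algebra_simps)
      then show ?thesis
        using c(2)[OF r] by simp
    qed
    then show "(\<lambda>n. padic_abs ((\<Sum>i<n. (T ^^ i) (of_int_vec (dig (r i)))) $ l - z $ l)) \<longlonglongrightarrow> 0"
      by (intro tendsto_sandwich[OF _ _ tendsto_const c(1)]) auto
  qed
  then show thesis
    using that[of "\<lambda>i. dig (r i)"] dq(1)[OF r] by blast
qed

text \<open>The partial sums are integral vectors, and they are Cauchy in each coordinate because contraction
  bounds all terms of a tail by the same small number.\<close>

lemma digit_series_converges:
  fixes A :: "int ^ 'd ^ 'd" and x :: "nat \<Rightarrow> int ^ 'd"
  defines "T \<equiv> (*v) (of_int_mat A) :: 'p::prime_card padic ^ 'd \<Rightarrow> 'p padic ^ 'd"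
  assumes con: "contracting T"
  obtains z where "z \<in> padic_integers" "(\<lambda>i. (T ^^ i) (of_int_vec (x i))) sums z"
proof -
  define s where "s n = (\<Sum>i<n. ((*v) A ^^ i) (x i))" for n
  have T: "(T ^^ i) (of_int_vec v) = of_int_vec (((*v) A ^^ i) v)" for i v
    unfolding T_def by (rule funpow_of_int_mat)
  have s: "(\<Sum>i<n. (T ^^ i) (of_int_vec (x i))) = of_int_vec (s n)" for n
    by (simp add: T s_def vec_eq_iff)
  obtain c where c: "c \<longlonglongrightarrow> 0" "\<And>n x l. x \<in> padic_integers \<Longrightarrow> padic_abs ((T ^^ n) x $ l) \<le> c n"
    using con unfolding contracting_def by blast
  have "\<exists>y :: 'p padic. (\<lambda>n. padic_abs (of_int (s n $ l) - y)) \<longlonglongrightarrow> 0" for l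
  proof -
    have cauchy: "\<exists>k. \<forall>m\<ge>k. \<forall>n\<ge>k. padic_abs (of_int (s m $ l - s n $ l) :: 'p padic) < r"
      if "r > 0" for r :: real
    proof -
      have "eventually (\<lambda>n. c n < r / 2) sequentially"
        using that by (intro order_tendstoD(2)[OF c(1)]) simp
      then obtain k where k: "\<And>n. n \<ge> k \<Longrightarrow> c n < r / 2"
        by (auto simp: eventually_sequentially)
      have near: "padic_abs (of_int (s m $ l - s n $ l) :: 'p padic) \<le> r / 2"
        if "k \<le> n" "n \<le> m" for m n
      proof -
        have "s m - s n = (\<Sum>i\<in>{n..<m}. ((*v) A ^^ i) (x i))"
          unfolding s_def using that(2) sum_diff_nat_ivl[of 0 n m "\<lambda>i. ((*v) A ^^ i) (x i)"]
          by (simp add: atLeast0LessThan)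
        then have "of_int (s m $ l - s n $ l) = (\<Sum>i\<in>{n..<m}. (T ^^ i) (of_int_vec (x i)) $ l)"
          by (simp add: T flip: vector_minus_component)
        also have "padic_abs \<dots> \<le> r / 2"
        proof (rule padic_abs_sum_le)
          fix i assume "i \<in> {n..<m}"
          then show "padic_abs ((T ^^ i) (of_int_vec (x i)) $ l) \<le> r / 2"
            using c(2)[of "of_int_vec (x i)" i l] k[of i] \<open>k \<le> n\<close> by simp
        qed (use \<open>r > 0\<close> in auto)
        finally show ?thesis .
      qed
      have "padic_abs (of_int (s m $ l - s n $ l) :: 'p padic) < r" if "k \<le> m" "k \<le> n" for m n
        using near[of n m] near[of m n] that \<open>r > 0\<close>
          padic_abs_diff_commute[of "of_int (s m $ l) :: 'p padic" "of_int (s n $ l)"]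
        by (cases "n \<le> m") auto
      then show ?thesis by blast
    qed
    show ?thesis
      by (rule padic_cauchy_of_int_convergent[OF cauchy]) blast+
  qed
  then obtain y :: "'d \<Rightarrow> 'p padic"
    where y: "\<And>l. (\<lambda>n. padic_abs (of_int (s n $ l) - y l)) \<longlonglongrightarrow> 0"
    by metis
  define z where "z = (\<chi> l. y l)"
  have "(\<lambda>i. (T ^^ i) (of_int_vec (x i))) sums z"
    unfolding sums_def padic_vec_tendsto_iff using y by (simp add: s z_def del: sum_component)
  moreover have "z \<in> padic_integers"
  proof (rule padic_integersI)
    fix l
    have "eventually (\<lambda>n. padic_abs (of_int (s n $ l) - y l) < 1) sequentially"
      using order_tendstoD(2)[OF y] by simp
    then obtain n where n: "padic_abs (of_int (s n $ l) - y l) < 1"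
      by (auto simp: eventually_sequentially)
    have "padic_abs (y l) \<le> max (padic_abs (of_int (s n $ l) :: 'p padic)) (padic_abs (of_int (s n $ l) - y l))"
      using padic_abs_diff_le[of "of_int (s n $ l)" "of_int (s n $ l) - y l"] by simp
    also have "\<dots> \<le> 1"
      using n by (intro max.boundedI) simp_all
    finally show "padic_abs (z $ l) \<le> 1"
      by (simp add: z_def)
  qed
  ultimately show thesis
    using that by blast
qed

text \<open>A vector outside the image has \<open>p\<close> multiples that are pairwise incongruent, because the
  integers strictly between \<open>-p\<close> and \<open>p\<close>, except zero, are units. So \<open>p\<close> digits can
  represent all classes only once.\<close>

lemma digits_incongruent:
  fixes A :: "int ^ 'd ^ 'd"
  defines "T \<equiv> (*v) (of_int_mat A) :: 'p::prime_card padic ^ 'd \<Rightarrow> 'p padic ^ 'd"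
  assumes con: "contracting T" and D: "digit_set TYPE('p) A D"
    and n: "n \<in> D" "n' \<in> D" "of_int_vec n - of_int_vec n' \<in> T ` padic_integers"
  shows "n = n'"
proof -
  let ?Z = "padic_integers :: ('p padic ^ 'd) set"
  have diff: "u - v \<in> T ` ?Z" if uv: "u \<in> T ` ?Z" "v \<in> T ` ?Z" for u v
  proof -
    obtain a b where ab: "u = T a" "v = T b" "a \<in> ?Z" "b \<in> ?Z"
      using uv by auto
    then have "u - v = T (a - b)"
      by (simp add: T_def matrix_vector_mult_diff_distrib)
    then show ?thesis
      using padic_integers_diff[OF ab(3,4)] by blast
  qed
  have scale: "a *s u \<in> T ` ?Z" if au: "padic_abs a \<le> 1" "u \<in> T ` ?Z" for a u
  proof -
    obtain b where b: "u = T b" "b \<in> ?Z"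
      using au(2) by auto
    then have "a *s u = T (a *s b)"
      by (simp add: T_def vector_scalar_commute)
    then show ?thesis
      using padic_integers_scale[OF au(1) b(2)] by blast
  qed
  \<comment> \<open>A contraction cannot be onto: the all-ones vector would be divisible by every power.\<close>
  have "T ` ?Z \<noteq> ?Z"
  proof
    assume surj: "T ` ?Z = ?Z"
    have "(T ^^ k) ` ?Z = ?Z" for k
    proof (induction k)
      case (Suc k)
      have "(T ^^ Suc k) ` ?Z = T ` (T ^^ k) ` ?Z" by (simp add: image_image)
      then show ?case using Suc surj by simp
    qed simp
    then have *: "\<exists>w\<in>?Z. of_int_vec (1 :: int ^ 'd) = (T ^^ k) w" for k
      using of_int_vec_padic_integers[of 1] by (metis imageE)
    obtain c where c: "c \<longlonglongrightarrow> 0" "\<And>n x l. x \<in> ?Z \<Longrightarrow> padic_abs ((T ^^ n) x $ l) \<le> c n"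
      using con unfolding contracting_def by blast
    have "1 \<le> c k" for k
    proof -
      obtain w where w: "w \<in> ?Z" "of_int_vec (1 :: int ^ 'd) = (T ^^ k) w"
        using * by blast
      have "padic_abs ((of_int_vec (1 :: int ^ 'd) :: 'p padic ^ 'd) $ undefined) \<le> c k"
        unfolding w(2) by (rule c(2)[OF w(1)])
      then show ?thesis by simp
    qed
    then have "1 \<le> (0::real)"
      by (intro LIMSEQ_le_const[OF c(1)]) auto
    then show False by simp
  qed
  moreover have "T ` ?Z \<subseteq> ?Z"
    unfolding T_def by (auto intro: of_int_mat_padic_integers)
  ultimately obtain g where g: "g \<in> ?Z" "g \<notin> T ` ?Z" by blast
  let ?P = "CARD('p)"
  have "\<exists>m\<in>D. of_nat j *s g - of_int_vec m \<in> T ` ?Z" for j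
  proof -
    have "of_nat j *s g \<in> ?Z"
      using padic_integers_scale[OF padic_abs_of_int_le_1[of "int j"] g(1)] by simp
    then show ?thesis
      using D unfolding digit_set_def T_def by blast
  qed
  then obtain f where f: "\<And>j. f j \<in> D" "\<And>j. of_nat j *s g - of_int_vec (f j) \<in> T ` ?Z"
    by metis
  have inj: "i = j" if ij: "i < ?P" "j < ?P" "of_int_vec (f i) - of_int_vec (f j) \<in> T ` ?Z" for i j
  proof (rule ccontr)
    assume "i \<noteq> j"
    define t where "t = int i - int j"
    have t: "t \<noteq> 0" "\<bar>t\<bar> < int ?P"
      using \<open>i \<noteq> j\<close> ij by (auto simp: t_def)
    have "(0 :: 'p padic ^ 'd) \<in> T ` ?Z"
      using scale[of 0, OF _ ij(3)] by simp
    then have neg: "- u \<in> T ` ?Z" if "u \<in> T ` ?Z" for u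
      using diff[of 0 u] that by simp
    have "of_nat i *s g - of_nat j *s g = (of_nat i *s g - of_int_vec (f i))
        - (of_nat j *s g - of_int_vec (f j)) - - (of_int_vec (f i) - of_int_vec (f j))"
      by (simp add: algebra_simps)
    also have "\<dots> \<in> T ` ?Z"
      by (intro diff neg f ij)
    also have "of_nat i *s g - of_nat j *s g = of_int t *s g"
      by (simp add: t_def vec_eq_iff algebra_simps)
    finally have tg: "of_int t *s g \<in> T ` ?Z" .
    have "\<not> int ?P dvd t"
      using t zdvd_not_zless[of "\<bar>t\<bar>" "int ?P"] by auto
    then have "padic_abs (of_int t :: 'p padic) = 1"
      using padic_abs_of_int_less_1_iff[of t, where 'p='p] padic_abs_of_int_le_1[of t, where 'p='p]
      by linarith
    then have "inverse (of_int t) *s (of_int t *s g) \<in> T ` ?Z"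
      by (intro scale tg) (simp add: padic_abs_inverse)
    moreover have "inverse (of_int t) *s (of_int t *s g) = g"
      using t by (simp add: vec_eq_iff)
    ultimately show False
      using g by simp
  qed
  have zero: "(0 :: 'p padic ^ 'd) \<in> T ` ?Z"
    using scale[of 0, OF _ n(3)] by simp
  have "inj_on f {..<?P}"
    using inj zero by (auto intro!: inj_onI)
  then have "card (f ` {..<?P}) = card D"
    using D by (simp add: card_image digit_set_def)
  moreover have "finite D"
    using D by (intro card_ge_0_finite) (simp add: digit_set_def)
  ultimately have "f ` {..<?P} = D"
    using f(1) by (intro card_subset_eq) auto
  then obtain i j where "i < ?P" "j < ?P" "n = f i" "n' = f j"
    using n by auto
  then show "n = n'"
    using inj n by auto
qed

section \<open>Haar measure of the inverse image of the integral vectors\<close>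

lemma open_padic_integers_translate: "open {x. x - a \<in> (padic_integers :: ('p::prime_card padic ^ 'd) set)}"
  unfolding open_dist
proof
  fix x :: "'p padic ^ 'd"
  assume "x \<in> {x. x - a \<in> padic_integers}"
  then have x: "x - a \<in> padic_integers" by simp
  have "y - a \<in> padic_integers" if "dist y x < 1" for y
  proof -
    have "y - x \<in> padic_integers"
      using that dist_vec_nth_le[of y _ x]
      by (intro padic_integersI) (simp add: dist_padic_def, smt (verit))
    then show ?thesis
      using padic_integers_add[OF _ x, of "y - x"] by simp
  qed
  then show "\<exists>e>0. \<forall>y. dist y x < e \<longrightarrow> y \<in> {x. x - a \<in> padic_integers}"
    using zero_less_one by blast
qed

lemma translate_padic_integers:
  "(+) a ` padic_integers = {x. x - a \<in> (padic_integers :: ('p::prime_card padic ^ 'd) set)}"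
  by (auto simp: image_iff) (metis add.commute diff_add_cancel)

text \<open>Dividing the class decomposition of the integral vectors by the matrix writes the inverse image
  as a disjoint union of one translate of the integral vectors for each digit.\<close>

lemma haar_measure_inverse_image:
  fixes A :: "int ^ 'd ^ 'd" and \<mu> :: "('p::prime_card padic ^ 'd) measure"
  defines "T \<equiv> (*v) (of_int_mat A) :: 'p padic ^ 'd \<Rightarrow> 'p padic ^ 'd"
  assumes det: "det A \<noteq> 0" and con: "contracting T" and D: "digit_set TYPE('p) A D"
    and haar: "padic_haar_measure \<mu>"
  shows "T -` padic_integers \<in> sets \<mu>" "emeasure \<mu> (T -` padic_integers) = ennreal (real CARD('p))"
proof -
  let ?Z = "padic_integers :: ('p padic ^ 'd) set"
  let ?S = "\<lambda>n. (*v) (matrix_inv (of_int_mat A)) (of_int_vec n) :: 'p padic ^ 'd"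
  have TS: "T (?S n) = of_int_vec n" for n
    unfolding T_def using det by (intro matrix_inv_cancel) (simp add: det_of_int_mat)
  have inj: "x = y" if "T x = T y" for x y
    using that matrix_inv_cancel(2)[of "of_int_mat A :: 'p padic ^ 'd ^ 'd"] det
    by (metis T_def det_of_int_mat of_int_padic_eq_0_iff)
  have Tdiff: "T (x - y) = T x - T y" and Tadd: "T (x + y) = T x + T y" for x y
    by (simp_all add: T_def matrix_vector_mult_diff_distrib matrix_vector_right_distrib)
  have sets: "sets \<mu> = sets borel"
    using haar by (simp add: padic_haar_measure_def)
  have meas: "(+) a ` ?Z \<in> sets \<mu>" for a
    unfolding sets translate_padic_integers by (rule borel_open[OF open_padic_integers_translate])
  have "?Z \<in> sets borel"
    using borel_open[OF open_padic_integers_translate[of 0]] by simp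
  then have emeas: "emeasure \<mu> ((+) a ` ?Z) = 1" for a
    using haar by (simp add: padic_haar_measure_def)
  have decomp: "T -` ?Z = (\<Union>n\<in>D. (+) (?S n) ` ?Z)"
  proof (intro equalityI subsetI)
    fix w assume "w \<in> T -` ?Z"
    then have "T w \<in> ?Z" by simp
    then obtain n v where nv: "n \<in> D" "v \<in> ?Z" "T w = of_int_vec n + of_int_mat A *v v"
      using digit_setD[OF D] by metis
    then have "T w = T (?S n + v)"
      by (simp add: Tadd TS) (simp add: T_def)
    then have "w = ?S n + v"
      by (rule inj)
    then show "w \<in> (\<Union>n\<in>D. (+) (?S n) ` ?Z)"
      using nv by blast
  next
    fix w assume "w \<in> (\<Union>n\<in>D. (+) (?S n) ` ?Z)"
    then obtain n v where "n \<in> D" "v \<in> ?Z" "w = ?S n + v" by auto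
    then show "w \<in> T -` ?Z"
      using of_int_mat_padic_integers[of v A]
      by (simp add: Tadd TS padic_integers_add) (simp add: T_def padic_integers_add)
  qed
  have fin: "finite D"
    using D by (intro card_ge_0_finite) (simp add: digit_set_def)
  have disj: "disjoint_family_on (\<lambda>n. (+) (?S n) ` ?Z) D"
    unfolding disjoint_family_on_def
  proof (intro ballI impI, rule ccontr)
    fix n n' assume n: "n \<in> D" "n' \<in> D" "n \<noteq> n'"
      and "(+) (?S n) ` ?Z \<inter> (+) (?S n') ` ?Z \<noteq> {}"
    then obtain v v' where v: "v \<in> ?Z" "v' \<in> ?Z" "?S n + v = ?S n' + v'" by auto
    then have "T (?S n) + T v = T (?S n') + T v'"
      by (metis Tadd)
    then have "of_int_vec n - of_int_vec n' = T (v' - v)"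
      by (simp add: TS Tdiff algebra_simps)
    then have "n = n'"
      using digits_incongruent[OF con[unfolded T_def] D n(1,2)] padic_integers_diff[OF v(2,1)]
      by (auto simp: T_def)
    then show False using n by blast
  qed
  show "T -` ?Z \<in> sets \<mu>"
    unfolding decomp using fin meas by auto
  have "emeasure \<mu> (T -` ?Z) = (\<Sum>n\<in>D. emeasure \<mu> ((+) (?S n) ` ?Z))"
    unfolding decomp using fin meas disj by (intro sum_emeasure[symmetric]) auto
  also have "\<dots> = ennreal (real CARD('p))"
    using D by (simp add: emeas digit_set_def ennreal_of_nat_eq_real_of_nat)
  finally show "emeasure \<mu> (T -` ?Z) = ennreal (real CARD('p))" .
qed

section \<open>Lebesgue measure of linear images\<close>

lemma det_shear:
  fixes m n :: "'d::finite"
  assumes "m \<noteq> n"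
  shows "det (matrix (\<lambda>v :: real ^ 'd. \<chi> i. if i = m then v $ m + v $ n else v $ i)) = 1"
proof -
  have "matrix (\<lambda>v :: real ^ 'd. \<chi> i. if i = m then v $ m + v $ n else v $ i)
      = (\<chi> k. if k = m then row m (mat 1) + 1 *s row n (mat 1) else row k (mat 1 :: real ^ 'd ^ 'd))"
    by (auto simp: vec_eq_iff matrix_def mat_def row_def axis_def)
  then show ?thesis
    by (simp only: det_row_operation[OF assms] det_I)
qed

text \<open>Translating the corner of the box to the origin gives it the nonnegative coordinate that
  \<open>measure_shear_interval\<close> requires.\<close>

lemma measure_shear_box:
  fixes a b :: "real ^ 'd::finite"
  assumes "m \<noteq> n"
  shows "measure lebesgue ((\<lambda>v. \<chi> i. if i = m then v $ m + v $ n else v $ i) ` cbox a b)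
    = measure lebesgue (cbox a b)" (is "measure lebesgue (?h ` _) = _")
proof (cases "cbox a b = {}")
  case False
  have lin: "linear ?h"
    by (rule linearI) (auto simp: vec_eq_iff algebra_simps)
  have box: "cbox a b = (+) a ` cbox 0 (b - a)"
    using cbox_translation[of a 0 "b - a"] by simp
  then have ne: "cbox 0 (b - a) \<noteq> {}"
    using False by auto
  have "?h ` cbox a b = (+) (?h a) ` ?h ` cbox 0 (b - a)"
    unfolding box image_image using linear_add[OF lin] by simp
  then have "measure lebesgue (?h ` cbox a b) = measure lebesgue (?h ` cbox 0 (b - a))"
    by (simp only: measure_translation)
  also have "\<dots> = measure lebesgue (cbox 0 (b - a))"
    using ne by (intro measure_shear_interval assms) auto
  also have "\<dots> = measure lebesgue (cbox a b)"
    unfolding box by (simp only: measure_translation)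
  finally show ?thesis .
qed simp

lemma
  fixes m n :: "'d::finite"
  assumes "m \<noteq> n"
  shows abs_det_swap:
      "\<bar>det (matrix (\<lambda>v :: real ^ 'd. \<chi> i. v $ Transposition.transpose m n i))\<bar> = 1"
    and measure_swap_box:
      "measure lebesgue ((\<lambda>v :: real ^ 'd. \<chi> i. v $ Transposition.transpose m n i) ` cbox a b)
        = measure lebesgue (cbox a b)"
proof -
  let ?s = "Transposition.transpose m n"
  let ?h = "\<lambda>v :: real ^ 'd. \<chi> i. v $ ?s i"
  have "matrix ?h = (\<chi> i. (mat 1 :: real ^ 'd ^ 'd) $ ?s i)"
    by (auto simp: vec_eq_iff matrix_def mat_def axis_def)
  then show "\<bar>det (matrix ?h)\<bar> = 1"
    by (simp add: det_permute_rows permutes_swap_id sign_swap_id)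
  have "?h ` cbox a b = cbox (?h a) (?h b)"
  proof (intro equalityI subsetI)
    fix v assume "v \<in> cbox (?h a) (?h b)"
    then have "\<forall>i. a $ ?s i \<le> v $ i \<and> v $ i \<le> b $ ?s i"
      by (simp add: mem_box_cart)
    then have "a $ ?s (?s i) \<le> v $ ?s i \<and> v $ ?s i \<le> b $ ?s (?s i)" for i
      by (rule spec)
    then have "?h v \<in> cbox a b"
      by (simp add: mem_box_cart)
    moreover have "v = ?h (?h v)"
      by (simp add: vec_eq_iff)
    ultimately show "v \<in> ?h ` cbox a b"
      by blast
  qed (auto simp: mem_box_cart)
  moreover have "cbox (?h a) (?h b) = {} \<longleftrightarrow> cbox a b = {}"
    by (metis calculation image_is_empty)
  moreover have "(\<Prod>i\<in>UNIV. b $ ?s i - a $ ?s i) = (\<Prod>i\<in>UNIV. b $ i - a $ i)"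
    using prod.permute[OF permutes_swap_id[of m UNIV n], of "\<lambda>i. b $ i - a $ i"] by (simp add: o_def)
  ultimately show "measure lebesgue (?h ` cbox a b) = measure lebesgue (cbox a b)"
    by (simp add: content_cbox_if_cart)
qed

text \<open>Both sides are multiplicative in the map, so the elementary maps suffice; for swaps and shears,
  which have determinant \<open>\<plusminus>1\<close>, it is enough to look at boxes. The determinant of a shear is found by a row
  operation rather than by triangularity, which would need an order on the index type.\<close>

lemma measure_linear_image_finite:
  fixes f :: "real ^ 'd \<Rightarrow> real ^ 'd"
  assumes "linear f" "S \<in> lmeasurable"
  shows "f ` S \<in> lmeasurable \<and> measure lebesgue (f ` S) = \<bar>det (matrix f)\<bar> * measure lebesgue S"
proof -
  let ?P = "\<lambda>f :: real ^ 'd \<Rightarrow> real ^ 'd. \<forall>S \<in> lmeasurable.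
    f ` S \<in> lmeasurable \<and> measure lebesgue (f ` S) = \<bar>det (matrix f)\<bar> * measure lebesgue S"
  have boxes: "?P h" if "linear h" "\<bar>det (matrix h)\<bar> = 1"
    "\<And>a b. measure lebesgue (h ` cbox a b) = measure lebesgue (cbox a b)" for h
  proof
    fix S :: "(real ^ 'd) set" assume S: "S \<in> lmeasurable"
    have "h ` S \<in> lmeasurable \<and> 1 * measure lebesgue S = measure lebesgue (h ` S)"
      by (rule measure_linear_sufficient[OF that(1) S]) (simp only: that(3) mult_1)
    then show "h ` S \<in> lmeasurable \<and> measure lebesgue (h ` S) = \<bar>det (matrix h)\<bar> * measure lebesgue S"
      unfolding that(2) by simp
  qed
  have "?P f"
  proof (rule induct_linear_elementary[OF assms(1)])
    fix f g :: "real ^ 'd \<Rightarrow> real ^ 'd"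
    assume fg: "linear f" "linear g" "?P f" "?P g"
    show "?P (f \<circ> g)"
    proof
      fix S :: "(real ^ 'd) set" assume "S \<in> lmeasurable"
      then have "g ` S \<in> lmeasurable" "measure lebesgue (g ` S) = \<bar>det (matrix g)\<bar> * measure lebesgue S"
        using fg(4) by auto
      then show "(f \<circ> g) ` S \<in> lmeasurable \<and>
          measure lebesgue ((f \<circ> g) ` S) = \<bar>det (matrix (f \<circ> g))\<bar> * measure lebesgue S"
        using fg(3) unfolding image_comp[symmetric] matrix_compose[OF fg(2,1)] det_mul abs_mult by simp
    qed
  next
    fix f :: "real ^ 'd \<Rightarrow> real ^ 'd" and i
    assume f: "linear f" "\<And>x. f x $ i = 0"
    then have "\<not> surj f"
      by (metis axis_nth surjE zero_neq_one)
    then have "\<not> inj f"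
      using f(1) linear_injective_imp_surjective by blast
    then have "negligible (f ` S)" "det (matrix f) = 0" for S
      using f(1) negligible_linear_singular_image det_nz_iff_inj by blast+
    then show "?P f"
      by (simp add: negligible_imp_measurable negligible_imp_measure0)
  next
    fix c :: "'d \<Rightarrow> real"
    have "matrix (\<lambda>x :: real ^ 'd. \<chi> i. c i * x $ i) = (\<chi> i j. if i = j then c i else 0)"
      by (auto simp: matrix_def axis_def vec_eq_iff)
    then have "det (matrix (\<lambda>x :: real ^ 'd. \<chi> i. c i * x $ i)) = prod c UNIV"
      by (simp add: det_diagonal)
    then show "?P (\<lambda>x. \<chi> i. c i * x $ i)"
      by (simp add: measurable_stretch measure_stretch)
  next
    fix m n :: 'd assume "m \<noteq> n"
    then show "?P (\<lambda>x. \<chi> i. x $ Transposition.transpose m n i)"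
      by (intro boxes abs_det_swap measure_swap_box linearI) (auto simp: vec_eq_iff)
  next
    fix m n :: 'd assume "m \<noteq> n"
    then show "?P (\<lambda>x. \<chi> i. if i = m then x $ m + x $ n else x $ i)"
      by (intro boxes measure_shear_box linearI) (auto simp: vec_eq_iff algebra_simps det_shear)
  qed
  then show ?thesis
    using assms(2) by blast
qed

section \<open>Integral translates that cover the space\<close>

lemma emeasure_lebesgue_translation:
  fixes S :: "'a::euclidean_space set"
  assumes "S \<in> sets lebesgue"
  shows "emeasure lebesgue ((+) a ` S) = emeasure lebesgue S"
  using emeasure_lebesgue_affine[of 1 a S] by (simp add: add.commute cong: image_cong_simp)

definition unit_cube :: "(real ^ 'd) set" where
  "unit_cube = {x. \<forall>i. 0 \<le> x $ i \<and> x $ i < 1}"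

lemma unit_cube_measurable: "unit_cube \<in> sets (lebesgue :: (real ^ 'd) measure)"
  and emeasure_unit_cube: "emeasure lebesgue (unit_cube :: (real ^ 'd) set) = 1"
proof -
  have "unit_cube \<in> sets (borel :: (real ^ 'd) measure)"
    unfolding unit_cube_def by measurable
  then show meas: "unit_cube \<in> sets (lebesgue :: (real ^ 'd) measure)"
    by simp
  have one: "(1 :: real ^ 'd) \<bullet> b = 1" if "b \<in> Basis" for b
    using that by (auto simp: Basis_vec_def inner_axis)
  have "box 0 1 \<subseteq> unit_cube" "unit_cube \<subseteq> cbox 0 (1 :: real ^ 'd)"
    by (auto simp: unit_cube_def mem_box_cart less_imp_le)
  then have "emeasure lebesgue (box 0 (1 :: real ^ 'd)) \<le> emeasure lebesgue (unit_cube :: (real ^ 'd) set)"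
    "emeasure lebesgue (unit_cube :: (real ^ 'd) set) \<le> emeasure lebesgue (cbox 0 (1 :: real ^ 'd))"
    by (intro emeasure_mono meas; simp)+
  moreover have "emeasure lebesgue (box 0 (1 :: real ^ 'd)) = 1"
    "emeasure lebesgue (cbox 0 (1 :: real ^ 'd)) = 1"
    by (simp_all add: emeasure_lborel_box_eq emeasure_lborel_cbox_eq one)
  ultimately show "emeasure lebesgue (unit_cube :: (real ^ 'd) set) = 1"
    by (simp add: antisym)
qed

lemma unit_cube_floor: "x - of_int_vec (\<chi> i. \<lfloor>x $ i\<rfloor>) \<in> unit_cube"
  by (simp add: unit_cube_def) linarith

lemma unit_cube_unique:
  fixes x :: "real ^ 'd"
  assumes "x - of_int_vec k \<in> unit_cube" "x - of_int_vec l \<in> unit_cube"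
  shows "k = l"
proof -
  have "k $ i = l $ i" for i
  proof -
    have "0 \<le> x $ i - of_int (k $ i)" "x $ i - of_int (k $ i) < 1"
      "0 \<le> x $ i - of_int (l $ i)" "x $ i - of_int (l $ i) < 1"
      using assms by (auto simp: unit_cube_def)
    then show ?thesis by linarith
  qed
  then show ?thesis
    by (simp add: vec_eq_iff)
qed

text \<open>Cut the set along the integral translates of the unit cube and move all pieces back into the
  unit cube: they cover it.\<close>

lemma covering_emeasure_ge_1:
  fixes F :: "(real ^ 'd) set"
  assumes F: "F \<in> sets lebesgue" and cover: "\<And>x. \<exists>k. x + of_int_vec k \<in> F"
  shows "1 \<le> emeasure lebesgue F"
proof -
  let ?v = "of_int_vec :: int ^ 'd \<Rightarrow> real ^ 'd"
  \<comment> \<open>The integral vectors are enumerated by their codes, and numbers that code none get the empty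
    piece.\<close>
  define G where "G n = (if n \<in> range (to_nat :: int ^ 'd \<Rightarrow> nat) then F \<inter> (+) (?v (from_nat n)) ` unit_cube else {})" for n
  define H where "H n = (+) (- ?v (from_nat n)) ` G n" for n
  have G: "range G \<subseteq> sets lebesgue"
    using F by (auto simp: G_def intro!: lebesgue_sets_translation unit_cube_measurable)
  then have Gn: "G n \<in> sets lebesgue" for n
    by blast
  have H: "range H \<subseteq> sets lebesgue" and eq: "emeasure lebesgue (H n) = emeasure lebesgue (G n)" for n
    unfolding H_def using lebesgue_sets_translation[OF Gn] emeasure_lebesgue_translation[OF Gn] by blast+
  have disj: "disjoint_family G"
    unfolding disjoint_family_on_def
  proof (intro ballI impI)
    fix m n :: nat assume "m \<noteq> n"
    show "G m \<inter> G n = {}"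
    proof (rule ccontr)
      assume "G m \<inter> G n \<noteq> {}"
      then obtain x where x: "x \<in> G m" "x \<in> G n" by blast
      then obtain k l :: "int ^ 'd" where kl: "m = to_nat k" "n = to_nat l"
        by (auto simp: G_def split: if_splits)
      then have "x \<in> (+) (?v k) ` unit_cube" "x \<in> (+) (?v l) ` unit_cube"
        using x by (simp_all add: G_def)
      moreover have "x - a \<in> unit_cube" if "x \<in> (+) a ` unit_cube" for a
        using that by auto
      ultimately have "x - ?v k \<in> unit_cube" "x - ?v l \<in> unit_cube"
        by blast+
      then show False
        using unit_cube_unique kl \<open>m \<noteq> n\<close> by blast
    qed
  qed
  have "unit_cube \<subseteq> (\<Union>n. H n)"
  proof
    fix x :: "real ^ 'd" assume x: "x \<in> unit_cube"
    obtain k where k: "x + ?v k \<in> F" using cover by blast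
    have "x + ?v k \<in> G (to_nat k)"
      using k x by (auto simp: G_def add.commute)
    then have "x \<in> H (to_nat k)"
      by (force simp: H_def)
    then show "x \<in> (\<Union>n. H n)" by blast
  qed
  then have "1 \<le> emeasure lebesgue (\<Union>n. H n)"
    using H emeasure_mono[of unit_cube "\<Union>n. H n" lebesgue] by (auto simp: emeasure_unit_cube)
  also have "\<dots> \<le> (\<Sum>n. emeasure lebesgue (H n))"
    using H by (rule emeasure_subadditive_countably)
  also have "\<dots> = emeasure lebesgue (\<Union>n. G n)"
    unfolding eq using G disj by (rule suminf_emeasure)
  also have "\<dots> \<le> emeasure lebesgue F"
    using F by (intro emeasure_mono) (auto simp: G_def split: if_splits)
  finally show ?thesis .
qed

text \<open>Removing the overlap with the translate by \<open>k\<close> leaves a covering set: from a point of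
  the set walk by steps of \<open>-k\<close>; by boundedness there is a last visit to the set, and it happens
  outside the overlap. So the overlap has to be null.\<close>

lemma covering_overlap_null:
  fixes R :: "(real ^ 'd) set"
  assumes R: "R \<in> sets lebesgue" "emeasure lebesgue R = 1" "bounded R"
    and cover: "\<And>x. \<exists>k. x + of_int_vec k \<in> R" and k: "k \<noteq> 0"
  shows "R \<inter> (+) (of_int_vec k) ` R \<in> null_sets lebesgue"
proof -
  let ?k = "of_int_vec k :: real ^ 'd"
  have kR: "(+) ?k ` R \<in> sets lebesgue"
    by (rule lebesgue_sets_translation[OF R(1)])
  obtain B where B: "\<And>x. x \<in> R \<Longrightarrow> norm x \<le> B"
    using R(3) by (auto simp: bounded_iff)
  have k0: "norm ?k > 0"
    using k by (auto simp: vec_eq_iff)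
  have "\<exists>l. x + of_int_vec l \<in> R - (+) ?k ` R" for x
  proof -
    obtain l where l: "x + of_int_vec l \<in> R" using cover by blast
    define y where "y = x + of_int_vec l"
    let ?N = "{n :: nat. y - real n *\<^sub>R ?k \<in> R}"
    have "n \<le> nat \<lceil>(B + norm y) / norm ?k\<rceil>" if "n \<in> ?N" for n
    proof -
      have "real n * norm ?k = norm (y - (y - real n *\<^sub>R ?k))" by simp
      also have "\<dots> \<le> norm y + norm (y - real n *\<^sub>R ?k)"
        by (rule norm_triangle_ineq4)
      also have "\<dots> \<le> norm y + B"
        using B that by simp
      finally have "real n \<le> (B + norm y) / norm ?k"
        using k0 by (simp add: pos_le_divide_eq add.commute)
      then show ?thesis by linarith
    qed
    then have fin: "finite ?N"
      by (auto intro: finite_subset[of _ "{..nat \<lceil>(B + norm y) / norm ?k\<rceil>}"])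
    define m where "m = Max ?N"
    have "0 \<in> ?N" using l by (simp add: y_def)
    then have m: "m \<in> ?N"
      using Max_in[OF fin] unfolding m_def by blast
    have "Suc m \<notin> ?N"
      using Max_ge[OF fin, of "Suc m"] by (auto simp: m_def)
    then have "y - real m *\<^sub>R ?k \<notin> (+) ?k ` R"
      by (auto simp: algebra_simps)
    moreover have "y - real m *\<^sub>R ?k = x + of_int_vec (l - of_nat m * k)"
      by (simp add: y_def vec_eq_iff of_nat_index)
    ultimately show ?thesis
      using m by (metis DiffI mem_Collect_eq)
  qed
  then have "1 \<le> emeasure lebesgue (R - (+) ?k ` R)"
    using R kR by (intro covering_emeasure_ge_1) auto
  moreover have "emeasure lebesgue (R - (+) ?k ` R) + emeasure lebesgue (R \<inter> (+) ?k ` R) = 1"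
    using R kR by (subst plus_emeasure) (auto simp: Int_Diff_disjoint Un_Diff_Int)
  ultimately have "1 + emeasure lebesgue (R \<inter> (+) ?k ` R) \<le> 1 + 0"
    by (metis add_right_mono add.right_neutral)
  then have "emeasure lebesgue (R \<inter> (+) ?k ` R) = 0"
    by (subst (asm) ennreal_add_left_cancel_le) simp
  then show ?thesis
    using R kR by (intro null_setsI) auto
qed

section \<open>Compactness of the set of all sums of a set-valued series\<close>

text \<open>If the series converges for every selection, then in each coordinate it converges for the
  selections that maximize and minimize the terms. So the widths of the sets are summable, and by the
  Weierstrass test the sum depends continuously on the selection, which ranges over a compact product.\<close>

lemma compact_selection_sums:
  fixes K :: "nat \<Rightarrow> 'a::euclidean_space set"
  assumes K: "\<And>i. compact (K i)" and sm: "\<And>v. (\<And>i. v i \<in> K i) \<Longrightarrow> summable v"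
  shows "compact {y. \<exists>v. (\<forall>i. v i \<in> K i) \<and> v sums y}"
proof (cases "\<forall>i. K i \<noteq> {}")
  case True
  then have "\<forall>i. \<exists>b. b \<in> K i" by blast
  then obtain b where b: "\<And>i. b i \<in> K i"
    by metis
  define X where "X = {v. \<forall>i. v i \<in> K i}"
  have X: "X = Pi\<^sub>E UNIV K"
    by (auto simp: X_def)
  have "compactin (product_topology (\<lambda>_. euclidean) UNIV) X"
    unfolding X compactin_PiE using K by simp
  then have cX: "compact X"
    by (simp add: euclidean_product_topology)
  have "\<exists>w. summable w \<and> (\<forall>i. \<forall>u\<in>K i. \<bar>(u - b i) \<bullet> c\<bar> \<le> w i)" for c
  proof -
    have "\<exists>u\<in>K i. \<forall>u'\<in>K i. u' \<bullet> c \<le> u \<bullet> c" "\<exists>u\<in>K i. \<forall>u'\<in>K i. u \<bullet> c \<le> u' \<bullet> c" for i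
      using True by (intro continuous_attains_sup continuous_attains_inf K continuous_intros; blast)+
    then obtain hi lo where hl: "\<And>i. hi i \<in> K i" "\<And>i u. u \<in> K i \<Longrightarrow> u \<bullet> c \<le> hi i \<bullet> c"
      "\<And>i. lo i \<in> K i" "\<And>i u. u \<in> K i \<Longrightarrow> lo i \<bullet> c \<le> u \<bullet> c"
      by metis
    have "summable (\<lambda>i. hi i \<bullet> c - lo i \<bullet> c)"
      by (intro summable_diff bounded_linear.summable[OF bounded_linear_inner_left] sm hl)
    moreover have "\<bar>(u - b i) \<bullet> c\<bar> \<le> hi i \<bullet> c - lo i \<bullet> c" if "u \<in> K i" for i u
      using hl(2,4)[OF that] hl(2,4)[OF b[of i]] by (auto simp: inner_diff_left)
    ultimately show ?thesis by blast
  qed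
  then obtain w where sw: "\<And>c. summable (w c)"
    and w: "\<And>c i u. u \<in> K i \<Longrightarrow> \<bar>(u - b i) \<bullet> c\<bar> \<le> w c i"
    by metis
  have "norm (v i - b i) \<le> (\<Sum>c\<in>Basis. w c i)" if "v \<in> X" for i v
  proof -
    have "v i \<in> K i"
      using that by (simp add: X_def)
    then show ?thesis
      by (intro order_trans[OF norm_le_l1] sum_mono w)
  qed
  then have "uniform_limit X (\<lambda>n v. \<Sum>i<n. v i - b i) (\<lambda>v. \<Sum>i. v i - b i) sequentially"
    by (rule Weierstrass_m_test) (use sw in \<open>auto intro: summable_sum\<close>)
  moreover have "continuous_on X (\<lambda>v. \<Sum>i<n. v i - b i)" for n
    by (intro continuous_intros continuous_on_subset[OF continuous_on_product_coordinates]) auto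
  ultimately have "continuous_on X (\<lambda>v. \<Sum>i. v i - b i)"
    by (intro uniform_limit_theorem) auto
  then have "continuous_on X (\<lambda>v. (\<Sum>i. v i - b i) + (\<Sum>i. b i))"
    by (intro continuous_intros)
  moreover have "(\<Sum>i. v i - b i) + (\<Sum>i. b i) = (\<Sum>i. v i)" if "v \<in> X" for v
    using suminf_diff[OF sm[of v] sm[OF b]] that by (simp add: X_def diff_eq_eq)
  ultimately have "continuous_on X suminf"
    by (simp cong: continuous_on_cong)
  then have "compact (suminf ` X)"
    using cX by (rule compact_continuous_image)
  also have "suminf ` X = {y. \<exists>v. (\<forall>i. v i \<in> K i) \<and> v sums y}"
  proof (intro equalityI subsetI)
    fix y assume "y \<in> suminf ` X"
    then obtain v where "\<forall>i. v i \<in> K i" "y = suminf v"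
      by (auto simp: X_def)
    then show "y \<in> {y. \<exists>v. (\<forall>i. v i \<in> K i) \<and> v sums y}"
      using summable_sums[OF sm[of v]] by blast
  qed (auto simp: X_def sums_iff)
  finally show ?thesis .
next
  case False
  then have "{y. \<exists>v. (\<forall>i. v i \<in> K i) \<and> v sums y} = {}" by blast
  then show ?thesis by (simp only: compact_empty)
qed

section \<open>The real digit tile\<close>

lemma digit_tile_eq:
  fixes A :: "int ^ 'd ^ 'd"
  defines "N \<equiv> matrix_inv (of_int_mat A :: real ^ 'd ^ 'd)"
  shows "digit_tile A D =
    {y. \<exists>x. (\<forall>i. x i \<in> D) \<and> (\<lambda>i. ((*v) N ^^ Suc i) (of_int_vec (x i))) sums y}"
proof -
  have "- int i - 1 = - int (Suc i)" for i by simp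
  then show ?thesis
    unfolding digit_tile_def N_def by (simp only: mat_power_int_minus_of_nat)
qed

lemma linear_funpow_mult: "linear ((*v) (N :: real ^ 'd ^ 'd) ^^ i)"
proof (induction i)
  case (Suc i)
  then show ?case
    using linear_compose[OF Suc matrix_vector_mul_linear[of N]] by (simp only: funpow.simps(2))
qed (simp add: linear_iff)

lemma compact_digit_series:
  fixes N :: "real ^ 'd ^ 'd" and D :: "(int ^ 'd) set"
  assumes "finite D"
    and sm: "\<And>x. (\<And>i. x i \<in> D) \<Longrightarrow> summable (\<lambda>i. ((*v) N ^^ Suc i) (of_int_vec (x i)))"
  shows "compact {y. \<exists>x. (\<forall>i. x i \<in> D) \<and> (\<lambda>i. ((*v) N ^^ Suc i) (of_int_vec (x i))) sums y}"
proof -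
  define K where "K i = (\<lambda>n. ((*v) N ^^ Suc i) (of_int_vec n)) ` D" for i
  have sel: "(\<forall>i. v i \<in> K i) \<longleftrightarrow> (\<exists>x. (\<forall>i. x i \<in> D) \<and> v = (\<lambda>i. ((*v) N ^^ Suc i) (of_int_vec (x i))))" for v
  proof
    assume "\<forall>i. v i \<in> K i"
    then have "\<forall>i. \<exists>n. n \<in> D \<and> v i = ((*v) N ^^ Suc i) (of_int_vec n)"
      unfolding K_def by blast
    then obtain x where "\<forall>i. x i \<in> D \<and> v i = ((*v) N ^^ Suc i) (of_int_vec (x i))"
      by (rule choice[THEN exE])
    then show "\<exists>x. (\<forall>i. x i \<in> D) \<and> v = (\<lambda>i. ((*v) N ^^ Suc i) (of_int_vec (x i)))"
      by (intro exI[of _ x] conjI ext) auto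
  qed (auto simp: K_def)
  have "summable v" if "\<And>i. v i \<in> K i" for v
    using sel[of v] sm that by blast
  then have "compact {y. \<exists>v. (\<forall>i. v i \<in> K i) \<and> v sums y}"
    using assms(1) by (intro compact_selection_sums) (auto simp: K_def intro: finite_imp_compact)
  moreover have "{y. \<exists>v. (\<forall>i. v i \<in> K i) \<and> v sums y}
      = {y. \<exists>x. (\<forall>i. x i \<in> D) \<and> (\<lambda>i. ((*v) N ^^ Suc i) (of_int_vec (x i))) sums y}"
    unfolding sel by blast
  ultimately show ?thesis by simp
qed

text \<open>The vectors with vanishing orbit form an invariant subspace that contains the digits, hence
  the tile; a proper subspace is a null set.\<close>

lemma inverse_powers_tendsto_0:
  fixes N :: "real ^ 'd ^ 'd" and D :: "(int ^ 'd) set"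
  defines "R \<equiv> {y. \<exists>x. (\<forall>i. x i \<in> D) \<and> (\<lambda>i. ((*v) N ^^ Suc i) (of_int_vec (x i))) sums y}"
  assumes sm: "\<And>x. (\<And>i. x i \<in> D) \<Longrightarrow> summable (\<lambda>i. ((*v) N ^^ Suc i) (of_int_vec (x i)))"
    and R: "\<not> negligible R"
  shows "(\<lambda>i. ((*v) N ^^ i) v) \<longlonglongrightarrow> 0"
proof -
  define W where "W = {v. (\<lambda>i. ((*v) N ^^ i) v) \<longlonglongrightarrow> 0}"
  have W: "subspace W"
  proof (rule subspaceI)
    show "0 \<in> W"
      by (simp add: W_def linear_0[OF linear_funpow_mult])
    show "x + y \<in> W" if "x \<in> W" "y \<in> W" for x y
      using that tendsto_add[of "\<lambda>i. ((*v) N ^^ i) x" 0 sequentially "\<lambda>i. ((*v) N ^^ i) y" 0]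
      by (simp add: W_def linear_add[OF linear_funpow_mult])
    show "c *\<^sub>R x \<in> W" if "x \<in> W" for c x
      using that tendsto_scaleR[OF tendsto_const, of "\<lambda>i. ((*v) N ^^ i) x" 0 sequentially c]
      by (simp add: W_def linear_cmul[OF linear_funpow_mult])
  qed
  have NW: "((*v) N ^^ k) v \<in> W" if "v \<in> W" for k v
  proof -
    have "(\<lambda>i. ((*v) N ^^ (i + k)) v) \<longlonglongrightarrow> 0"
      using that unfolding W_def by (intro LIMSEQ_ignore_initial_segment) simp
    then show ?thesis
      by (simp add: W_def funpow_add)
  qed
  have DW: "of_int_vec n \<in> W" if "n \<in> D" for n
  proof -
    have "(\<lambda>i. ((*v) N ^^ Suc i) (of_int_vec n)) \<longlonglongrightarrow> 0"
      using sm[of "\<lambda>_. n"] that by (intro summable_LIMSEQ_zero) simp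
    then show ?thesis
      unfolding W_def using filterlim_sequentially_Suc[of "\<lambda>i. ((*v) N ^^ i) (of_int_vec n)"] by blast
  qed
  have "R \<subseteq> W"
  proof
    fix y assume "y \<in> R"
    then obtain x where x: "\<And>i. x i \<in> D" "(\<lambda>i. ((*v) N ^^ Suc i) (of_int_vec (x i))) sums y"
      by (auto simp: R_def)
    have "(\<Sum>i<n. ((*v) N ^^ Suc i) (of_int_vec (x i))) \<in> W" for n
      by (intro subspace_sum[OF W] NW DW x(1))
    then show "y \<in> W"
      using x(2) unfolding sums_def by (rule closed_sequentially[OF closed_subspace[OF W]])
  qed
  then have "\<not> negligible W"
    using R negligible_subset by blast
  then have "dim W = DIM(real ^ 'd)"
    using negligible_lowdim[of W] dim_subset_UNIV[of W] by linarith
  then have "W = UNIV"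
    using W by (metis dim_eq_full span_eq_iff)
  then show ?thesis
    by (auto simp: W_def)
qed

text \<open>The union of all integral translates of the tile is invariant under the inverse of the matrix,
  so it contains translates of arbitrarily fine
  lattices and is dense. It is closed because the tile is compact.\<close>

lemma tile_translates_cover:
  fixes A :: "int ^ 'd ^ 'd" and D :: "(int ^ 'd) set"
  defines "M \<equiv> of_int_mat A :: real ^ 'd ^ 'd"
  defines "N \<equiv> matrix_inv M"
  defines "R \<equiv> {y. \<exists>x. (\<forall>i. x i \<in> D) \<and> (\<lambda>i. ((*v) N ^^ Suc i) (of_int_vec (x i))) sums y}"
  assumes det: "det M \<noteq> 0" and R: "compact R" "R \<noteq> {}"
    and N0: "\<And>v. (\<lambda>i. ((*v) N ^^ i) v) \<longlonglongrightarrow> 0"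
    and res: "\<And>k. \<exists>n\<in>D. k - n \<in> range ((*v) A)"
  shows "\<exists>k. x + of_int_vec k \<in> R"
proof -
  have NM: "N *v (M *v v) = v" for v
    using matrix_inv_cancel(2)[OF det] by (simp add: N_def)
  have shift: "N *v (y + of_int_vec n) \<in> R" if y: "y \<in> R" and n: "n \<in> D" for y n
  proof -
    obtain x where x: "\<And>i. x i \<in> D" "(\<lambda>i. ((*v) N ^^ Suc i) (of_int_vec (x i))) sums y"
      using y by (auto simp: R_def)
    let ?x = "case_nat n x"
    have "(\<lambda>i. N *v ((*v) N ^^ Suc i) (of_int_vec (x i))) sums (N *v y)"
      using bounded_linear.sums[OF matrix_vector_mul_bounded_linear x(2)] by simp
    then have "(\<lambda>i. ((*v) N ^^ Suc (Suc i)) (of_int_vec (?x (Suc i)))) sums (N *v y)"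
      by simp
    then have "(\<lambda>i. ((*v) N ^^ Suc i) (of_int_vec (?x i))) sums (N *v y + N *v of_int_vec n)"
      using sums_Suc[of "\<lambda>i. ((*v) N ^^ Suc i) (of_int_vec (?x i))"] by simp
    moreover have "?x i \<in> D" for i
      using n x(1) by (cases i) auto
    ultimately show ?thesis
      unfolding R_def by (auto simp: matrix_vector_right_distrib)
  qed
  define S where "S = (\<Union>y\<in>R. \<Union>k\<in>range of_int_vec. {y + k :: real ^ 'd})"
  have S_I: "y + of_int_vec k \<in> S" if "y \<in> R" for y k
    using that unfolding S_def by blast
  have NS: "(*v) N s \<in> S" if s: "s \<in> S" for s
  proof -
    obtain y k where yk: "y \<in> R" "s = y + of_int_vec k"
      using s unfolding S_def by blast
    obtain n l where n: "n \<in> D" "k - n = A *v l"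
      using res[of k] by auto
    then have "of_int_vec k = of_int_vec n + M *v of_int_vec l"
      unfolding M_def of_int_mat_mult_of_int_vec by (simp flip: of_int_vec_add) (metis add.commute diff_add_cancel)
    then have "N *v s = N *v (y + of_int_vec n) + of_int_vec l"
      by (simp add: yk matrix_vector_right_distrib NM)
    then show ?thesis
      using S_I[OF shift[OF yk(1) n(1)]] by simp
  qed
  have NSk: "((*v) N ^^ i) s \<in> S" if "s \<in> S" for s i
    using that by (induction i) (auto simp: NS)
  have "range of_int_vec = {v :: real ^ 'd. \<forall>i. v $ i \<in> \<int>}"
  proof (intro equalityI subsetI)
    fix v :: "real ^ 'd" assume "v \<in> {v. \<forall>i. v $ i \<in> \<int>}"
    then have "v = of_int_vec (\<chi> i. \<lfloor>v $ i\<rfloor>)"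
      by (auto simp: vec_eq_iff elim!: Ints_cases)
    then show "v \<in> range of_int_vec" by blast
  qed auto
  also have "closed \<dots>"
    by (intro closed_Collect_all closed_vimage[OF closed_Ints, unfolded vimage_def] continuous_intros)
  finally have "closed S"
    unfolding S_def by (intro compact_closed_sums R)
  obtain y where y: "y \<in> R" using R by blast
  have "\<exists>s\<in>S. norm (x - s) \<le> (\<Sum>j\<in>UNIV. norm (((*v) N ^^ i) (axis j 1)))" for i
  proof -
    \<comment> \<open>Round to the lattice after enlarging by the power of the matrix, then shrink back: the
      rounding error shrinks as well.\<close>
    define u where "u = ((*v) M ^^ i) x - y"
    define k where "k = (\<chi> j. \<lfloor>u $ j\<rfloor>)"
    define e where "e = u - of_int_vec k"
    have e: "\<bar>e $ j\<bar> \<le> 1" for j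
      using unit_cube_floor[of u] by (auto simp: e_def k_def unit_cube_def less_imp_le)
    have inv: "((*v) N ^^ i) (((*v) M ^^ i) x) = x"
    proof (induction i)
      case (Suc i)
      then show ?case
        by (simp only: funpow_Suc_right[of i "(*v) N"] funpow.simps(2)[of i "(*v) M"] o_apply NM)
    qed simp
    have "x = ((*v) N ^^ i) ((y + of_int_vec k) + e)"
      by (simp add: e_def u_def inv)
    then have "x - ((*v) N ^^ i) (y + of_int_vec k) = ((*v) N ^^ i) e"
      by (metis add_diff_cancel_left' linear_add[OF linear_funpow_mult])
    also have "e = (\<Sum>j\<in>UNIV. e $ j *\<^sub>R axis j 1)"
      by (simp add: vec_eq_iff axis_def if_distrib cong: if_cong)
    also have "((*v) N ^^ i) \<dots> = (\<Sum>j\<in>UNIV. e $ j *\<^sub>R ((*v) N ^^ i) (axis j 1))"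
      by (simp add: linear_sum[OF linear_funpow_mult] linear_cmul[OF linear_funpow_mult])
    also have "norm \<dots> \<le> (\<Sum>j\<in>UNIV. norm (((*v) N ^^ i) (axis j 1)))"
      by (rule sum_norm_le) (use e in \<open>simp add: mult_left_le_one_le\<close>)
    finally show ?thesis
      using NSk[OF S_I[OF y]] by blast
  qed
  then obtain s where s: "\<And>i. s i \<in> S"
    "\<And>i. norm (x - s i) \<le> (\<Sum>j\<in>UNIV. norm (((*v) N ^^ i) (axis j 1)))"
    by metis
  have "(\<lambda>i. \<Sum>j\<in>UNIV. norm (((*v) N ^^ i) (axis j 1 :: real ^ 'd))) \<longlonglongrightarrow> (\<Sum>j\<in>(UNIV :: 'd set). 0)"
    by (intro tendsto_sum tendsto_norm_zero N0)
  then have "(\<lambda>i. x - s i) \<longlonglongrightarrow> 0"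
    using s(2) by (intro Lim_null_comparison[of "\<lambda>i. x - s i"]) auto
  then have "s \<longlonglongrightarrow> x"
    using LIM_zero_cancel[of "\<lambda>i. - s i" "- x"] tendsto_minus_cancel by fastforce
  then have "x \<in> S"
    by (rule closed_sequentially[OF \<open>closed S\<close> s(1)])
  then obtain y k where "y \<in> R" "x = y + of_int_vec k"
    unfolding S_def by blast
  moreover have "y + of_int_vec k + of_int_vec (- k) = y"
    by (simp add: vec_eq_iff)
  ultimately have "x + of_int_vec (- k) \<in> R"
    by metis
  then show ?thesis by blast
qed

section \<open>The digit map\<close>

lemma mat_power_int_pred:
  fixes M :: "'a::field ^ 'n ^ 'n"
  assumes "det M \<noteq> 0"
  shows "mat_power_int M (- 1 + int n) *v v = matrix_inv M *v ((*v) M ^^ n) v"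
proof (cases n)
  case 0
  then show ?thesis
    using mat_power_int_minus_of_nat[of M 1 v] by simp
next
  case (Suc m)
  then show ?thesis
    using mat_power_int_of_nat[of M m v] matrix_inv_cancel(2)[OF assms] by simp
qed

lemma digit_map_series:
  fixes A :: "int ^ 'd ^ 'd" and \<rho> :: "'p::prime_card padic ^ 'd \<Rightarrow> real ^ 'd"
  defines "T \<equiv> (*v) (of_int_mat A) :: 'p padic ^ 'd \<Rightarrow> 'p padic ^ 'd"
    and "N \<equiv> matrix_inv (of_int_mat A :: real ^ 'd ^ 'd)"
  assumes \<rho>: "digit_map A D \<rho>" and x: "\<And>i. x i \<in> D"
    and z: "(\<lambda>i. (T ^^ i) (of_int_vec (x i))) sums z"
  shows "(\<lambda>i. ((*v) N ^^ Suc i) (of_int_vec (x i))) sums \<rho> z"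
proof -
  have "(\<lambda>n. mat_power_int (of_int_mat A) (- (0 + int n) - 1) *v of_int_vec (x (nat (0 + int n)))) sums \<rho> z"
    using \<rho>[unfolded digit_map_def, rule_format, of 0 "\<lambda>i. x (nat i)" z] x z
    by (simp add: mat_power_int_of_nat T_def)
  moreover have "- (0 + int n) - 1 = - int (Suc n)" for n by simp
  ultimately show ?thesis
    by (simp only: mat_power_int_minus_of_nat N_def) simp
qed

text \<open>Starting the same digit sequence at index \<open>-1\<close> instead of \<open>0\<close> divides the p-adic sum by the
  matrix and multiplies the real sum by it.\<close>

lemma digit_map_shift:
  fixes A :: "int ^ 'd ^ 'd" and \<rho> :: "'p::prime_card padic ^ 'd \<Rightarrow> real ^ 'd"
  defines "T \<equiv> (*v) (of_int_mat A) :: 'p padic ^ 'd \<Rightarrow> 'p padic ^ 'd"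
  assumes \<rho>: "digit_map A D \<rho>" and det: "det A \<noteq> 0" and x: "\<And>i. x i \<in> D"
    and w: "(\<lambda>i. (T ^^ i) (of_int_vec (x i))) sums T w"
  shows "\<rho> w = of_int_mat A *v \<rho> (T w)"
proof -
  let ?M = "of_int_mat A :: real ^ 'd ^ 'd" and ?P = "of_int_mat A :: 'p padic ^ 'd ^ 'd"
  have detR: "det ?M \<noteq> 0" and detP: "det ?P \<noteq> 0"
    using det by (simp_all add: det_of_int_mat)
  have "(\<lambda>i. matrix_inv ?P *v (T ^^ i) (of_int_vec (x i))) sums w"
  proof -
    have "(\<Sum>i<n. matrix_inv ?P *v (T ^^ i) (of_int_vec (x i)))
        = matrix_inv ?P *v (\<Sum>i<n. (T ^^ i) (of_int_vec (x i)))" for n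
      by (induction n) (simp_all add: matrix_vector_right_distrib)
    moreover have "w = matrix_inv ?P *v T w"
      by (simp add: T_def matrix_inv_cancel(2)[OF detP])
    ultimately show ?thesis
      using padic_matrix_mult_tendsto[of _ "T w" sequentially "matrix_inv ?P"] w
      unfolding sums_def by simp
  qed
  then have "(\<lambda>n. mat_power_int ?P (- 1 + int n) *v of_int_vec (x (nat (- 1 + int n + 1)))) sums w"
    by (simp only: mat_power_int_pred[OF detP]) (simp add: T_def)
  then have "(\<lambda>n. mat_power_int ?M (- (- 1 + int n) - 1) *v of_int_vec (x (nat (- 1 + int n + 1)))) sums \<rho> w"
    using \<rho>[unfolded digit_map_def, rule_format, of "- 1" "\<lambda>i. x (nat (i + 1))" w] x by simp
  moreover have "- (- 1 + int n) - 1 = - int n" for n by simp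
  ultimately have 1: "(\<lambda>n. ((*v) (matrix_inv ?M) ^^ n) (of_int_vec (x n))) sums \<rho> w"
    by (simp only: mat_power_int_minus_of_nat) simp
  have "(\<lambda>n. ?M *v ((*v) (matrix_inv ?M) ^^ Suc n) (of_int_vec (x n))) sums (?M *v \<rho> (T w))"
    using bounded_linear.sums[OF matrix_vector_mul_bounded_linear
        digit_map_series[OF \<rho> x w[unfolded T_def], folded T_def]] .
  then have 2: "(\<lambda>n. ((*v) (matrix_inv ?M) ^^ n) (of_int_vec (x n))) sums (?M *v \<rho> (T w))"
    by (simp add: matrix_inv_cancel(1)[OF detR])
  show ?thesis
    using sums_unique2[OF 1 2] .
qed

lemma digit_map_image_integers:
  fixes A :: "int ^ 'd ^ 'd" and \<rho> :: "'p::prime_card padic ^ 'd \<Rightarrow> real ^ 'd"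
  assumes con: "contracting ((*v) (of_int_mat A) :: 'p padic ^ 'd \<Rightarrow> _)"
    and D: "digit_set TYPE('p) A D" and \<rho>: "digit_map A D \<rho>"
  shows "\<rho> ` padic_integers = digit_tile A D"
proof (intro equalityI subsetI)
  fix y assume "y \<in> \<rho> ` padic_integers"
  then obtain z where z: "z \<in> padic_integers" "y = \<rho> z" by blast
  obtain x where x: "\<And>i. x i \<in> D"
    "(\<lambda>i. ((*v) (of_int_mat A) ^^ i) (of_int_vec (x i))) sums z"
    by (rule digit_expansion_exists[OF con D z(1)]) blast
  then show "y \<in> digit_tile A D"
    using digit_map_series[OF \<rho> x] by (auto simp: digit_tile_eq z(2))
next
  fix y assume "y \<in> digit_tile A D"
  then obtain x where x: "\<And>i. x i \<in> D"
    "(\<lambda>i. ((*v) (matrix_inv (of_int_mat A)) ^^ Suc i) (of_int_vec (x i))) sums y"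
    by (auto simp: digit_tile_eq)
  obtain z where z: "z \<in> padic_integers"
    "(\<lambda>i. ((*v) (of_int_mat A) ^^ i) (of_int_vec (x i))) sums (z :: 'p padic ^ 'd)"
    by (rule digit_series_converges[OF con, of x]) blast
  have "y = \<rho> z"
    by (rule sums_unique2[OF x(2) digit_map_series[OF \<rho> x(1) z(2)]])
  then show "y \<in> \<rho> ` padic_integers"
    using z(1) by blast
qed

lemma digit_map_image_inverse_image:
  fixes A :: "int ^ 'd ^ 'd" and \<rho> :: "'p::prime_card padic ^ 'd \<Rightarrow> real ^ 'd"
  defines "T \<equiv> (*v) (of_int_mat A) :: 'p padic ^ 'd \<Rightarrow> 'p padic ^ 'd"
  assumes con: "contracting T" and D: "digit_set TYPE('p) A D" and \<rho>: "digit_map A D \<rho>"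
    and det: "det A \<noteq> 0"
  shows "\<rho> ` (T -` padic_integers) = (*v) (of_int_mat A) ` digit_tile A D"
proof -
  have "\<rho> w = of_int_mat A *v \<rho> (T w)" if Tw: "T w \<in> padic_integers" for w
  proof -
    obtain x where "\<And>i. x i \<in> D" "(\<lambda>i. (T ^^ i) (of_int_vec (x i))) sums T w"
      unfolding T_def
      by (rule digit_expansion_exists[OF con[unfolded T_def] D Tw[unfolded T_def]]) blast
    then show ?thesis
      unfolding T_def by (intro digit_map_shift[OF \<rho> det])
  qed
  then have "\<rho> ` (T -` padic_integers) = (\<lambda>w. of_int_mat A *v \<rho> (T w)) ` (T -` padic_integers)"
    by (intro image_cong) auto
  also have "\<dots> = (*v) (of_int_mat A) ` \<rho> ` T ` (T -` padic_integers)"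
    by (simp only: image_image)
  also have "T ` (T -` padic_integers) = padic_integers"
  proof -
    have "z = T (matrix_inv (of_int_mat A) *v z)" for z
      unfolding T_def using det by (intro matrix_inv_cancel(1)[symmetric]) (simp add: det_of_int_mat)
    then have "surj T"
      by (metis surjI)
    then show ?thesis
      by (rule surj_image_vimage_eq)
  qed
  also have "\<rho> ` padic_integers = digit_tile A D"
    using digit_map_image_integers con D \<rho> unfolding T_def by blast
  finally show ?thesis .
qed

text \<open>By Cramer's rule the entries of a solution of an integral system are fractions with
  denominator \<open>\<plusminus>p\<close>; being p-adic integers, they are integers.\<close>

lemma integral_preimage:
  fixes A :: "int ^ 'd ^ 'd" and w :: "'p::prime_card padic ^ 'd"
  assumes det: "\<bar>det A\<bar> = int CARD('p)" and w: "w \<in> padic_integers"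
    and v: "of_int_vec v = of_int_mat A *v w"
  shows "v \<in> range ((*v) A)"
proof -
  have p: "int CARD('p) > 1"
    using CARD_prime_card_gt_1[where 'p='p] by simp
  have "\<exists>m :: int. w $ k = of_int m" for k
  proof -
    define B :: "int ^ 'd ^ 'd" where "B = (\<chi> i j. if j = k then v $ i else A $ i $ j)"
    have "(\<chi> i j. if j = k then (of_int_mat A *v w) $ i else of_int_mat A $ i $ j) = (of_int_mat B :: 'p padic ^ 'd ^ 'd)"
      by (simp add: vec_eq_iff B_def v[symmetric])
    then have B: "of_int (det B) = w $ k * of_int (det A)"
      using cramer_lemma[of k "of_int_mat A" w] by (simp add: det_of_int_mat)
    have "padic_abs (of_int (det A) :: 'p padic) < 1"
      unfolding padic_abs_of_int_less_1_iff using det by (metis dvd_abs_iff dvd_refl)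
    then have "padic_abs (of_int (det B) :: 'p padic) < 1"
      unfolding B padic_abs_mult using padic_integersD[OF w, of k]
      by (smt (verit) mult_left_le_one_le padic_abs_nonneg)
    then have "int CARD('p) dvd det B"
      by (simp add: padic_abs_of_int_less_1_iff)
    then have "det A dvd det B"
      using det by (metis abs_dvd_iff)
    then obtain m where m: "det B = det A * m" ..
    have "w $ k * of_int (det A) = of_int m * of_int (det A)"
      unfolding B[symmetric] m by (simp add: mult.commute)
    moreover have "of_int (det A) \<noteq> (0 :: 'p padic)"
      using det p by auto
    ultimately show ?thesis
      using mult_right_cancel by blast
  qed
  then obtain m where m: "\<And>k. w $ k = of_int (m k)"
    by metis
  have "w = of_int_vec (\<chi> k. m k)"
    by (simp add: vec_eq_iff m)
  then have "of_int_vec (v - A *v (\<chi> k. m k)) = (0 :: 'p padic ^ 'd)"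
    by (simp add: of_int_vec_diff v of_int_mat_mult_of_int_vec)
  then have "(v - A *v (\<chi> k. m k)) $ i = 0" for i
    by (metis of_int_vec_nth of_int_padic_eq_0_iff zero_index)
  then have "v - A *v (\<chi> k. m k) = 0"
    by (metis vec_eq_iff zero_index)
  then show ?thesis
    by simp
qed

lemma digits_residue_system:
  fixes A :: "int ^ 'd ^ 'd"
  assumes con: "contracting ((*v) (of_int_mat A) :: 'p::prime_card padic ^ 'd \<Rightarrow> _)"
    and D: "digit_set TYPE('p) A D" and det: "\<bar>det A\<bar> = int CARD('p)"
  shows "\<exists>!n. n \<in> D \<and> z - n \<in> range ((*v) A)"
proof -
  obtain n w where n: "n \<in> D" and w: "w \<in> (padic_integers :: ('p padic ^ 'd) set)"
    and z: "of_int_vec z = of_int_vec n + of_int_mat A *v w"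
    by (rule digit_setD[OF D of_int_vec_padic_integers[of z]])
  have "z - n \<in> range ((*v) A)"
    by (rule integral_preimage[OF det w]) (simp add: of_int_vec_diff z)
  moreover have "n = n'" if n': "n' \<in> D" "z - n' \<in> range ((*v) A)" for n'
  proof -
    obtain k l where "z - n = A *v k" "z - n' = A *v l"
      using n' \<open>z - n \<in> _\<close> by blast
    then have "n - n' = A *v (l - k)"
      by (simp add: matrix_vector_mult_diff_distrib algebra_simps)
    then have "of_int_vec n - of_int_vec n' = of_int_mat A *v (of_int_vec (l - k) :: 'p padic ^ 'd)"
      by (simp add: of_int_mat_mult_of_int_vec flip: of_int_vec_diff)
    then show ?thesis
      by (intro digits_incongruent[OF con D n n'(1)]) auto
  qed
  ultimately show ?thesis
    using n by blast
qed

section \<open>Measure-preserving digit maps\<close>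

theorem lemma16:
  fixes \<delta> :: "'p::prime_card padic ^ 'd \<Rightarrow> 'p padic ^ 'd \<Rightarrow> real"
    and A :: "int ^ 'd ^ 'd"
    and D :: "(int ^ 'd) set"
    and \<mu> :: "('p padic ^ 'd) measure"
    and \<rho> :: "'p padic ^ 'd \<Rightarrow> real ^ 'd"
  assumes "deformed_ultrametric \<delta>"
    and "dilation \<delta> ((*v) (of_int_mat A))"
    and "padic_abs (det (of_int_mat A :: 'p padic ^ 'd ^ 'd)) = 1 / real CARD('p)"
    and "digit_set TYPE('p) A D"
    and "digit_map A D \<rho>"
    and "padic_haar_measure \<mu>"
    and "conserves_measure \<mu> \<rho>"
  shows "(\<forall>z. \<exists>!n. n \<in> D \<and> z - n \<in> range ((*v) A))
    \<and> digit_tile A D \<in> sets lebesgue \<and> emeasure lebesgue (digit_tile A D) = 1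
    \<and> (\<forall>k :: int ^ 'd. k \<noteq> 0 \<longrightarrow>
         digit_tile A D \<inter> (+) (of_int_vec k) ` digit_tile A D \<in> null_sets lebesgue)
    \<and> padic_abs (det (of_int_mat A :: 'p padic ^ 'd ^ 'd))
        = inverse \<bar>det (of_int_mat A :: real ^ 'd ^ 'd)\<bar>"
proof -
  note D = assms(4) and \<rho> = assms(5) and haar = assms(6) and cons = assms(7)
  let ?Z = "padic_integers :: ('p padic ^ 'd) set"
  let ?T = "(*v) (of_int_mat A) :: 'p padic ^ 'd \<Rightarrow> 'p padic ^ 'd"
  let ?M = "of_int_mat A :: real ^ 'd ^ 'd"
  let ?N = "matrix_inv ?M"
  let ?R = "digit_tile A D"
  have p: "real CARD('p) > 1"
    using CARD_prime_card_gt_1[where 'p='p] by simp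
  have con: "contracting ?T"
    by (rule dilation_contracting[OF assms(1,2)])
  have det0: "det A \<noteq> 0"
  proof
    assume "det A = 0"
    then show False using assms(3) p by (simp add: det_of_int_mat)
  qed
  then have detM: "det ?M \<noteq> 0"
    by (simp add: det_of_int_mat)
  have Z: "?Z \<in> sets \<mu>" "emeasure \<mu> ?Z = 1"
    using haar borel_open[OF open_padic_integers_translate[of "0 :: 'p padic ^ 'd"]]
    by (simp_all add: padic_haar_measure_def)
  have R: "?R \<in> sets lebesgue" "emeasure lebesgue ?R = 1"
    using cons Z unfolding conserves_measure_def digit_map_image_integers[OF con D \<rho>, symmetric] by auto
  then have Rm: "?R \<in> lmeasurable" and R1: "measure lebesgue ?R = 1"
    by (auto simp: fmeasurable_def measure_def)
  \<comment> \<open>The inverse image of the integral vectors consists of \<open>p\<close> of their translates, and \<open>\<rho>\<close> maps it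
    onto the image of the tile under the matrix.\<close>
  have "emeasure lebesgue ((*v) ?M ` ?R) = ennreal (real CARD('p))"
    using cons haar_measure_inverse_image[OF det0 con D haar]
    unfolding conserves_measure_def digit_map_image_inverse_image[OF con D \<rho> det0, symmetric] by auto
  then have "measure lebesgue ((*v) ?M ` ?R) = real CARD('p)"
    by (simp add: measure_def)
  moreover have "measure lebesgue ((*v) ?M ` ?R) = \<bar>det ?M\<bar> * measure lebesgue ?R"
    using measure_linear_image_finite[OF matrix_vector_mul_linear[of ?M] Rm] by simp
  ultimately have det: "\<bar>det ?M\<bar> = real CARD('p)"
    by (simp add: R1)
  then have "\<bar>det A\<bar> = int CARD('p)"
    by (simp add: det_of_int_mat)
  then have res: "\<exists>!n. n \<in> D \<and> z - n \<in> range ((*v) A)" for z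
    by (rule digits_residue_system[OF con D])
  have sm: "summable (\<lambda>i. ((*v) ?N ^^ Suc i) (of_int_vec (x i)))" if x: "\<And>i. x i \<in> D" for x
  proof -
    obtain z where z: "(\<lambda>i. (?T ^^ i) (of_int_vec (x i))) sums z"
      by (rule digit_series_converges[OF con, of x])
    show ?thesis
      by (rule sums_summable[OF digit_map_series[OF \<rho> x z]])
  qed
  have "finite D"
    using D by (intro card_ge_0_finite) (simp add: digit_set_def)
  then have cR: "compact ?R"
    unfolding digit_tile_eq by (rule compact_digit_series[OF _ sm])
  have neg: "\<not> negligible ?R"
    using R1 negligible_imp_measure0 by fastforce
  have N0: "(\<lambda>i. ((*v) ?N ^^ i) v) \<longlonglongrightarrow> 0" for v
    by (rule inverse_powers_tendsto_0[OF sm neg[unfolded digit_tile_eq]])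
  have "?R \<noteq> {}" using R1 by auto
  have cover: "\<exists>k. y + of_int_vec k \<in> ?R" for y
    using cR \<open>?R \<noteq> {}\<close> unfolding digit_tile_eq
    by (rule tile_translates_cover[OF detM _ _ N0]) (use res in blast)
  show ?thesis
    using res R covering_overlap_null[OF R compact_imp_bounded[OF cR] cover] det assms(3)
    by (simp add: divide_inverse)
qed

end
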